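(* Let $k$ be a modulus and $\alpha_0,\beta_0,\phi\in\mathbb{C}$ free constants, and put $z_0=(\alpha_0-\beta_0)/2$, $\gamma_e=(\alpha_0+\beta_0)/2$, $\gamma_o=(\phi-\alpha_0-\beta_0)/2$, $z_n=(\gamma_e+\gamma_o)n+z_0$, $\gamma_n=\gamma_e$ for even $n$ and $\gamma_n=\gamma_o$ for odd $n$. Let $\xi_0$ be a free constant and, for $n\in\mathbb{Z}$, let $$v_{n,n}=\sqrt{k}\,\mathrm{sn}\big(\xi_0+n(\alpha_0-\beta_0)+n(n-1)\phi\big),\qquad v_{n,n+1}=\sqrt{k}\,\mathrm{sn}\big(\xi_0-\beta_0+n(\alpha_0-\beta_0)+n^2\phi\big).$$ Then, with the identification $$(u_{2n},u_{2n+1})=\left(\frac{v_{n,n}}{\sqrt{k}},\frac{v_{n,n+1}}{\sqrt{k}}\right),\qquad n\in\mathbb{Z},$$ this defines a particular solution of the difference equation $$\begin{aligned}&\mathrm{cn}(\gamma_n)\mathrm{dn}(\gamma_n)\big(1-k^2\mathrm{sn}^4(z_n)\big)u_n(u_{n+1}+u_{n-1})\\&-\mathrm{cn}(z_n)\mathrm{dn}(z_n)\big(1-k^2\mathrm{sn}^2(z_n)\mathrm{sn}^2(\gamma_n)\big)(u_{n+1}u_{n-1}+u_n^2)\\&+\big(\mathrm{cn}^2(z_n)-\mathrm{cn}^2(\gamma_n)\big)\mathrm{cn}(z_n)\mathrm{dn}(z_n)\big(1+k^2u_n^2u_{n+1}u_{n-1}\big)=0,\qquad n\in\mathbb{Z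}.\end{aligned}$$
   Context: $\mathrm{sn},\mathrm{cn},\mathrm{dn}$ are the Jacobi elliptic functions of modulus $k$; $n$ is the independent variable and $u_n$ the dependent variable of the difference equation.
   Formalization: The identification is corrected to (u_{2n-1},u_{2n}) = (v_{n,n},v_{n,n+1})/sqrt(k), since the printed labels fail already at n=0 for generic phi; k is nonzero, and the equation is asserted for those n at which none of the arguments of sn, cn, dn in it is a pole. *)

theory Defs
  imports "HOL-Complex_Analysis.Complex_Analysis"
begin

text \<open>
  The Jacobi elliptic functions of modulus \<open>k\<close> are the meromorphic functions
  \<open>sn, cn, dn\<close> on the complex plane with
  \<open>sn' = cn dn\<close>, \<open>cn' = - sn dn\<close>, \<open>dn' = - k\<^sup>2 sn cn\<close>,
  \<open>sn 0 = 0\<close>, \<open>cn 0 = dn 0 = 1\<close>.  The initial value problem determines their germs at 0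
  and hence the meromorphic functions; \<open>nicely_meromorphic_on\<close> also fixes the values
  at the poles (to 0), so that the triple is unique as a triple of HOL functions.
\<close>

definition jacobi_triple ::
  "complex \<Rightarrow> (complex \<Rightarrow> complex) \<Rightarrow> (complex \<Rightarrow> complex) \<Rightarrow> (complex \<Rightarrow> complex) \<Rightarrow> bool" where
  "jacobi_triple k s c d \<longleftrightarrow>
     s nicely_meromorphic_on UNIV \<and> c nicely_meromorphic_on UNIV \<and> d nicely_meromorphic_on UNIV \<and>
     s analytic_on {0} \<and> c analytic_on {0} \<and> d analytic_on {0} \<and>
     s 0 = 0 \<and> c 0 = 1 \<and> d 0 = 1 \<and>
     (\<forall>w. s analytic_on {w} \<and> c analytic_on {w} \<and> d analytic_on {w} \<longrightarrow>
        (s has_field_derivative c w * d w) (at w) \<and>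
        (c has_field_derivative - (s w * d w)) (at w) \<and>
        (d has_field_derivative - (k\<^sup>2 * s w * c w)) (at w))"

definition jacobi_sn :: "complex \<Rightarrow> complex \<Rightarrow> complex" where
  "jacobi_sn k = (THE s. \<exists>c d. jacobi_triple k s c d)"

definition jacobi_cn :: "complex \<Rightarrow> complex \<Rightarrow> complex" where
  "jacobi_cn k = (THE c. \<exists>s d. jacobi_triple k s c d)"

definition jacobi_dn :: "complex \<Rightarrow> complex \<Rightarrow> complex" where
  "jacobi_dn k = (THE d. \<exists>s c. jacobi_triple k s c d)"

text \<open>
  For \<open>k \<noteq> 0\<close> the three functions have the same poles
  (\<open>sn\<^sup>2 + cn\<^sup>2 = 1\<close>, \<open>k\<^sup>2 sn\<^sup>2 + dn\<^sup>2 = 1\<close>), so regularity is expressed through \<open>sn\<close> alone.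
\<close>

definition jacobi_regular :: "complex \<Rightarrow> complex \<Rightarrow> bool" where
  "jacobi_regular k w \<longleftrightarrow> \<not> is_pole (jacobi_sn k) w"

end

(*
  Near 0 the functions (s, c, d) are obtained by inverting the elliptic integral
  F(t) = \<integral> dt / sqrt ((1 - t^2) (1 - k^2 t^2)); since F (s w) = w for every solution of the
  initial value problem, its germ is unique.  Uniqueness gives the duplication formulas.
  With N = exp (- k^2 \<integral>\<integral> s^2) the quadruple (s N, c N, d N, N) is duplicated by a homogeneous
  quartic map, so the values at z are read off from those at z / 2^n and all four functions
  become entire; their quotients are sn, cn, dn.

  Along the orbit, x (n + 1) = x n + \<gamma> n + z n and x (n - 1) = x n + \<gamma> n - z n.  With
  y = x n + \<gamma> n, the addition theorem gives the sum and the product of the sn (y \<plusminus> z n) as rational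
  functions of sn\<^sup>2 y, and the difference equation reduces to Euler's symmetric biquadratic
  relation between sn (x n) and sn y.  Poles of sn y and zeros of the denominators are no
  obstacle because the equation with cleared denominators is an identity of entire functions.
*)
theory Submission
  imports Defs
begin

section \<open>Local solutions\<close>

definition jacobi_germ ::
  "complex \<Rightarrow> real \<Rightarrow> (complex \<Rightarrow> complex) \<Rightarrow> (complex \<Rightarrow> complex) \<Rightarrow> (complex \<Rightarrow> complex) \<Rightarrow> bool" where
  "jacobi_germ k r s c d \<longleftrightarrow> 0 < r \<and> s 0 = 0 \<and> c 0 = 1 \<and> d 0 = 1 \<and>
     (\<forall>w\<in>ball 0 r. (s has_field_derivative c w * d w) (at w) \<and>
        (c has_field_derivative - (s w * d w)) (at w) \<and>
        (d has_field_derivative - (k\<^sup>2 * s w * c w)) (at w))"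

lemma jacobi_germD:
  assumes "jacobi_germ k r s c d"
  shows "0 < r" "s 0 = 0" "c 0 = 1" "d 0 = 1"
    and "\<And>w. w \<in> ball 0 r \<Longrightarrow> (s has_field_derivative c w * d w) (at w)"
    and "\<And>w. w \<in> ball 0 r \<Longrightarrow> (c has_field_derivative - (s w * d w)) (at w)"
    and "\<And>w. w \<in> ball 0 r \<Longrightarrow> (d has_field_derivative - (k\<^sup>2 * s w * c w)) (at w)"
  using assms by (auto simp: jacobi_germ_def)

lemma jacobi_germ_mono:
  assumes "jacobi_germ k r s c d" "0 < r'" "r' \<le> r"
  shows "jacobi_germ k r' s c d"
  using assms by (auto simp: jacobi_germ_def)

lemma jacobi_germ_holomorphic:
  assumes "jacobi_germ k r s c d"
  shows "s holomorphic_on ball 0 r" "c holomorphic_on ball 0 r" "d holomorphic_on ball 0 r"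
  unfolding holomorphic_on_open[OF open_ball] using jacobi_germD(5-7)[OF assms] by blast+

lemma zero_derivative_convex_constant:
  fixes f :: "complex \<Rightarrow> complex"
  assumes "convex A" "\<And>w. w \<in> A \<Longrightarrow> (f has_field_derivative 0) (at w)" "w \<in> A" "w' \<in> A"
  shows "f w = f w'"
  using has_field_derivative_zero_constant[of A f] assms has_field_derivative_at_within by metis

lemma jacobi_germ_squares:
  assumes "jacobi_germ k r s c d" "w \<in> ball 0 r"
  shows "(c w)\<^sup>2 = 1 - (s w)\<^sup>2" "(d w)\<^sup>2 = 1 - k\<^sup>2 * (s w)\<^sup>2"
proof -
  note g = jacobi_germD[OF assms(1)]
  have 0: "0 \<in> ball (0::complex) r" using g(1) by simp
  have "(s w)\<^sup>2 + (c w)\<^sup>2 = (s 0)\<^sup>2 + (c 0)\<^sup>2"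
    by (rule zero_derivative_convex_constant[OF convex_ball _ assms(2) 0])
      (auto intro!: derivative_eq_intros g(5-7) simp: algebra_simps)
  then show "(c w)\<^sup>2 = 1 - (s w)\<^sup>2" using g(2,3) by (simp add: eq_diff_eq add.commute)
  have "k\<^sup>2 * (s w)\<^sup>2 + (d w)\<^sup>2 = k\<^sup>2 * (s 0)\<^sup>2 + (d 0)\<^sup>2"
    by (rule zero_derivative_convex_constant[OF convex_ball _ assms(2) 0])
      (auto intro!: derivative_eq_intros g(5-7) simp: algebra_simps)
  then show "(d w)\<^sup>2 = 1 - k\<^sup>2 * (s w)\<^sup>2" using g(2,4) by (simp add: eq_diff_eq add.commute)
qed

text \<open>The integrand is 1 at 0, so its primitive \<open>F\<close> is injective near 0 and the
  derivative of the inverse \<open>G\<close> is the reciprocal of the integrand. Positive real parts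
  keep both \<open>csqrt\<close> away from the branch cut. Existence takes \<open>s = G\<close>;
  uniqueness also uses \<open>F\<close>.\<close>

lemma elliptic_integral_local_inverse:
  fixes k :: complex
  obtains \<rho> F G where "0 < \<rho>" "F 0 = 0" "open (F ` ball 0 \<rho>)"
    "\<And>t. t \<in> ball 0 \<rho> \<Longrightarrow> 0 < Re (1 - t\<^sup>2) \<and> 0 < Re (1 - k\<^sup>2 * t\<^sup>2)"
    "\<And>t. t \<in> ball 0 \<rho> \<Longrightarrow>
       (F has_field_derivative inverse (csqrt (1 - t\<^sup>2) * csqrt (1 - k\<^sup>2 * t\<^sup>2))) (at t)"
    "\<And>t. t \<in> ball 0 \<rho> \<Longrightarrow> G (F t) = t"
    "\<And>t. t \<in> ball 0 \<rho> \<Longrightarrow>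
       (G has_field_derivative csqrt (1 - t\<^sup>2) * csqrt (1 - k\<^sup>2 * t\<^sup>2)) (at (F t))"
proof -
  define h where "h = (\<lambda>t. csqrt (1 - t\<^sup>2) * csqrt (1 - k\<^sup>2 * t\<^sup>2))"
  have "\<forall>\<^sub>F t in nhds 0. 0 < Re (1 - t\<^sup>2) \<and> 0 < Re (1 - k\<^sup>2 * t\<^sup>2)"
  proof (intro eventually_conj)
    have "((\<lambda>t. Re (1 - t\<^sup>2)) \<longlongrightarrow> Re (1 - 0\<^sup>2)) (nhds 0)"
      by (intro tendsto_intros) (auto simp: filterlim_ident)
    then show "\<forall>\<^sub>F t in nhds 0. 0 < Re (1 - t\<^sup>2)" by (rule order_tendstoD) simp
    have "((\<lambda>t. Re (1 - k\<^sup>2 * t\<^sup>2)) \<longlongrightarrow> Re (1 - k\<^sup>2 * 0\<^sup>2)) (nhds 0)"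
      by (intro tendsto_intros) (auto simp: filterlim_ident)
    then show "\<forall>\<^sub>F t in nhds 0. 0 < Re (1 - k\<^sup>2 * t\<^sup>2)" by (rule order_tendstoD) simp
  qed
  then obtain \<rho>0 where \<rho>0: "0 < \<rho>0"
    and pos: "\<And>t. t \<in> ball 0 \<rho>0 \<Longrightarrow> 0 < Re (1 - t\<^sup>2) \<and> 0 < Re (1 - k\<^sup>2 * t\<^sup>2)"
    by (auto simp: eventually_nhds_metric dist_commute)
  have nonpos: "z \<notin> \<real>\<^sub>\<le>\<^sub>0" if "0 < Re z" for z
    using that by (auto simp: complex_nonpos_Reals_iff)
  have hne: "h t \<noteq> 0" if "t \<in> ball 0 \<rho>0" for t
    using pos[OF that] unfolding h_def by (metis csqrt_eq_0 less_irrefl mult_eq_0_iff zero_complex.sel(1))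
  have "(\<lambda>t. inverse (h t)) holomorphic_on ball 0 \<rho>0"
    using pos hne nonpos unfolding h_def by (intro holomorphic_intros) auto
  then obtain F0 where F0: "\<And>t. t \<in> ball 0 \<rho>0 \<Longrightarrow> (F0 has_field_derivative inverse (h t)) (at t within ball 0 \<rho>0)"
    using holomorphic_convex_primitive'[of "ball 0 \<rho>0" "\<lambda>t. inverse (h t)"] by (metis convex_ball open_ball)
  define F where "F = (\<lambda>t. F0 t - F0 0)"
  have F: "(F has_field_derivative inverse (h t)) (at t)" if "t \<in> ball 0 \<rho>0" for t
    using F0[OF that] that unfolding F_def at_within_open[OF that open_ball]
    by (auto intro!: derivative_eq_intros)
  have Fhol: "F holomorphic_on ball 0 \<rho>0"
    unfolding holomorphic_on_open[OF open_ball] using F by blast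
  have "deriv F 0 \<noteq> 0"
    using DERIV_imp_deriv[OF F[of 0]] \<rho>0 hne[of 0] by simp
  then obtain \<rho> where \<rho>: "\<rho> > 0" "ball (0::complex) \<rho> \<subseteq> ball 0 \<rho>0" "inj_on F (ball 0 \<rho>)"
    by (rule has_complex_derivative_locally_injective[OF Fhol centre_in_ball[THEN iffD2, OF \<rho>0] open_ball])
  have Fhol': "F holomorphic_on ball 0 \<rho>" using Fhol \<rho>(2) by (rule holomorphic_on_subset)
  obtain G where G: "G holomorphic_on F ` ball 0 \<rho>"
    "\<And>t. t \<in> ball 0 \<rho> \<Longrightarrow> deriv F t * deriv G (F t) = 1"
    "\<And>t. t \<in> ball 0 \<rho> \<Longrightarrow> G (F t) = t"
    using holomorphic_has_inverse[OF Fhol' open_ball \<rho>(3)] by metis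
  have op: "open (F ` ball 0 \<rho>)" by (rule open_mapping_thm3[OF Fhol' open_ball \<rho>(3)])
  have dG: "(G has_field_derivative h t) (at (F t))" if "t \<in> ball 0 \<rho>" for t
  proof -
    have t: "t \<in> ball 0 \<rho>0" using that \<rho> by auto
    have "deriv F t = inverse (h t)" using F[OF t] by (rule DERIV_imp_deriv)
    then have "deriv G (F t) = h t" using G(2)[OF that] by (metis inverse_inverse_eq inverse_unique)
    then show ?thesis using holomorphic_derivI[OF G(1) op, of "F t"] that by auto
  qed
  show thesis
    by (rule that[of \<rho> F G])
      (use \<rho> op pos F dG G(3) in \<open>auto simp: F_def h_def\<close>)
qed

lemma jacobi_germ_exists: "\<exists>r s c d. jacobi_germ k r s c d"
proof -
  obtain \<rho> F G where FG: "0 < \<rho>" "F 0 = 0" "open (F ` ball 0 \<rho>)"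
    "\<And>t. t \<in> ball 0 \<rho> \<Longrightarrow> 0 < Re (1 - t\<^sup>2) \<and> 0 < Re (1 - k\<^sup>2 * t\<^sup>2)"
    "\<And>t. t \<in> ball 0 \<rho> \<Longrightarrow>
       (F has_field_derivative inverse (csqrt (1 - t\<^sup>2) * csqrt (1 - k\<^sup>2 * t\<^sup>2))) (at t)"
    "\<And>t. t \<in> ball 0 \<rho> \<Longrightarrow> G (F t) = t"
    "\<And>t. t \<in> ball 0 \<rho> \<Longrightarrow>
       (G has_field_derivative csqrt (1 - t\<^sup>2) * csqrt (1 - k\<^sup>2 * t\<^sup>2)) (at (F t))"
    using elliptic_integral_local_inverse[of k] by metis
  have "0 \<in> F ` ball 0 \<rho>" using FG(1,2) by (auto intro!: image_eqI[of _ _ 0])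
  then obtain r where r: "r > 0" "ball 0 r \<subseteq> F ` ball 0 \<rho>"
    using FG(3) openE by blast
  have G0: "G 0 = 0" using FG(1,2) FG(6)[of 0] by simp
  have nonpos: "z \<notin> \<real>\<^sub>\<le>\<^sub>0" if "0 < Re z" for z
    using that by (auto simp: complex_nonpos_Reals_iff)
  \<comment> \<open>The equation for \<open>G\<close> holds by construction; differentiating the two
    principal roots then produces the other two equations.\<close>
  have "jacobi_germ k r G (\<lambda>w. csqrt (1 - (G w)\<^sup>2)) (\<lambda>w. csqrt (1 - k\<^sup>2 * (G w)\<^sup>2))"
    unfolding jacobi_germ_def
  proof (intro conjI ballI)
    fix w :: complex assume "w \<in> ball 0 r"
    then obtain t where t: "t \<in> ball 0 \<rho>" "w = F t" using r by blast
    have Gw: "G w = t" using FG(6) t by simp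
    have p: "1 - t\<^sup>2 \<notin> \<real>\<^sub>\<le>\<^sub>0" "1 - k\<^sup>2 * t\<^sup>2 \<notin> \<real>\<^sub>\<le>\<^sub>0" using FG(4)[OF t(1)] nonpos by auto
    then have ne: "csqrt (1 - t\<^sup>2) \<noteq> 0" "csqrt (1 - k\<^sup>2 * t\<^sup>2) \<noteq> 0" by auto
    show d: "(G has_field_derivative csqrt (1 - (G w)\<^sup>2) * csqrt (1 - k\<^sup>2 * (G w)\<^sup>2)) (at w)"
      using FG(7)[OF t(1)] Gw t(2) by simp
    show "((\<lambda>w. csqrt (1 - (G w)\<^sup>2)) has_field_derivative - (G w * csqrt (1 - k\<^sup>2 * (G w)\<^sup>2))) (at w)"
      by (rule derivative_eq_intros d refl)+ (use p ne Gw in \<open>auto simp: field_simps\<close>)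
    show "((\<lambda>w. csqrt (1 - k\<^sup>2 * (G w)\<^sup>2)) has_field_derivative - (k\<^sup>2 * G w * csqrt (1 - (G w)\<^sup>2))) (at w)"
      by (rule derivative_eq_intros d refl)+ (use p ne Gw in \<open>auto simp: field_simps\<close>)
  qed (use r G0 in auto)
  then show ?thesis by blast
qed

text \<open>Every solution is compared with the one inverse \<open>G\<close>. Continuity keeps
  \<open>c\<close> and \<open>d\<close> in the right half plane near 0, which makes them principal
  square roots; then \<open>F (s w)\<close> has derivative 1, so \<open>F (s w) = w\<close>.\<close>

lemma jacobi_germ_unique_near:
  assumes g1: "jacobi_germ k r s c d" and g2: "jacobi_germ k r' s' c' d'"
  shows "\<forall>\<^sub>F w in nhds 0. s w = s' w \<and> c w = c' w \<and> d w = d' w"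
proof -
  obtain \<rho> F G where FG: "0 < \<rho>" "F 0 = 0" "open (F ` ball 0 \<rho>)"
    "\<And>t. t \<in> ball 0 \<rho> \<Longrightarrow> 0 < Re (1 - t\<^sup>2) \<and> 0 < Re (1 - k\<^sup>2 * t\<^sup>2)"
    "\<And>t. t \<in> ball 0 \<rho> \<Longrightarrow>
       (F has_field_derivative inverse (csqrt (1 - t\<^sup>2) * csqrt (1 - k\<^sup>2 * t\<^sup>2))) (at t)"
    "\<And>t. t \<in> ball 0 \<rho> \<Longrightarrow> G (F t) = t"
    using elliptic_integral_local_inverse[of k] by metis
  have ev: "\<forall>\<^sub>F w in nhds 0. s w = G w \<and> c w = csqrt (1 - (G w)\<^sup>2) \<and> d w = csqrt (1 - k\<^sup>2 * (G w)\<^sup>2)"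
    if g: "jacobi_germ k r s c d" for r s c d
  proof -
    note gD = jacobi_germD[OF g]
    have 0: "0 \<in> ball (0::complex) r" using gD(1) by simp
    have lim: "(s \<longlongrightarrow> 0) (nhds 0)" "(c \<longlongrightarrow> 1) (nhds 0)" "(d \<longlongrightarrow> 1) (nhds 0)"
      using gD(2-4) DERIV_isCont[OF gD(5)[OF 0]] DERIV_isCont[OF gD(6)[OF 0]] DERIV_isCont[OF gD(7)[OF 0]]
      by (auto simp: isCont_def tendsto_nhds_iff)
    have "\<forall>\<^sub>F w in nhds 0. s w \<in> ball 0 \<rho>" using tendstoD[OF lim(1) FG(1)] by (simp add: dist_commute)
    moreover have "((\<lambda>w. Re (c w)) \<longlongrightarrow> 1) (nhds 0)" "((\<lambda>w. Re (d w)) \<longlongrightarrow> 1) (nhds 0)"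
      using lim(2,3)[THEN tendsto_Re] by auto
    note this[THEN order_tendstoD(1), OF zero_less_one]
    moreover have "\<forall>\<^sub>F w in nhds 0. w \<in> ball 0 r" using gD(1) by (intro eventually_nhds_in_open) auto
    ultimately have "\<forall>\<^sub>F w in nhds 0. w \<in> ball 0 r \<and> s w \<in> ball 0 \<rho> \<and> 0 < Re (c w) \<and> 0 < Re (d w)"
      by eventually_elim auto
    then obtain \<epsilon> where \<epsilon>: "0 < \<epsilon>" and P: "\<And>w. w \<in> ball 0 \<epsilon> \<Longrightarrow>
        w \<in> ball 0 r \<and> s w \<in> ball 0 \<rho> \<and> 0 < Re (c w) \<and> 0 < Re (d w)"
      by (auto simp: eventually_nhds_metric dist_commute)
    have cd: "c w = csqrt (1 - (s w)\<^sup>2)" "d w = csqrt (1 - k\<^sup>2 * (s w)\<^sup>2)" if "w \<in> ball 0 \<epsilon>" for w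
      using P[OF that] jacobi_germ_squares[OF g, of w, symmetric]
      by (auto simp: csqrt_square)
    have "F (s w) - w = F (s 0) - 0" if w: "w \<in> ball 0 \<epsilon>" for w
    proof (rule zero_derivative_convex_constant[OF convex_ball _ w])
      fix w :: complex assume w: "w \<in> ball 0 \<epsilon>"
      have ne: "c w \<noteq> 0" "d w \<noteq> 0" using P[OF w] by auto
      have "((\<lambda>w. F (s w)) has_field_derivative inverse (csqrt (1 - (s w)\<^sup>2) * csqrt (1 - k\<^sup>2 * (s w)\<^sup>2)) * (c w * d w)) (at w)"
        using P[OF w] by (intro DERIV_chain2[OF FG(5) gD(5)]) auto
      then have "((\<lambda>w. F (s w)) has_field_derivative 1) (at w)"
        using ne unfolding cd[OF w, symmetric] by (simp add: field_simps)
      then show "((\<lambda>w. F (s w) - w) has_field_derivative 0) (at w)"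
        by (auto intro!: derivative_eq_intros)
    qed (use \<epsilon> in simp)
    then have "s w = G w" if "w \<in> ball 0 \<epsilon>" for w
      using FG(2) FG(6)[of "s w"] P[OF that] that gD(2) by simp
    moreover have "\<forall>\<^sub>F w in nhds 0. w \<in> ball 0 \<epsilon>" using \<epsilon> by (intro eventually_nhds_in_open) auto
    ultimately show ?thesis
      using cd by (auto elim!: eventually_mono)
  qed
  show ?thesis using ev[OF g1] ev[OF g2] by eventually_elim simp
qed

lemma holomorphic_eq_of_eventually_eq:
  assumes "f holomorphic_on A" "g holomorphic_on A" "open A" "connected A" "a \<in> A"
    and "\<forall>\<^sub>F w in nhds a. f w = g w" and "w \<in> A"
  shows "f w = g w"
proof -
  obtain U where U: "open U" "a \<in> U" "\<And>w. w \<in> U \<Longrightarrow> f w = g w"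
    using assms(6) by (auto simp: eventually_nhds)
  show ?thesis
    by (rule analytic_continuation_open[of "U \<inter> A" A f g]) (use U assms in auto)
qed

lemma jacobi_germ_unique:
  assumes g1: "jacobi_germ k r s c d" and g2: "jacobi_germ k r s' c' d'" and w: "w \<in> ball 0 r"
  shows "s w = s' w" "c w = c' w" "d w = d' w"
proof -
  have r: "0 \<in> ball (0::complex) r" using jacobi_germD(1)[OF g1] by simp
  note ev = jacobi_germ_unique_near[OF g1 g2]
  note h = jacobi_germ_holomorphic[OF g1] jacobi_germ_holomorphic[OF g2]
  note eq = holomorphic_eq_of_eventually_eq[OF _ _ open_ball convex_connected[OF convex_ball] r _ w]
  show "s w = s' w" using ev by (intro eq[OF h(1,4)]) (auto elim: eventually_mono)
  show "c w = c' w" using ev by (intro eq[OF h(2,5)]) (auto elim: eventually_mono)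
  show "d w = d' w" using ev by (intro eq[OF h(3,6)]) (auto elim: eventually_mono)
qed

section \<open>Duplication and addition near 0\<close>

text \<open>Duplication comes from uniqueness, not from addition: the right-hand sides of the
  duplication formulas, taken at \<open>w / 2\<close>, satisfy the same initial value problem on a
  ball of twice the radius.\<close>

lemma jacobi_germ_double:
  assumes g: "jacobi_germ k r s c d" and q: "\<And>w. w \<in> ball 0 r \<Longrightarrow> 1 - k\<^sup>2 * s w ^ 4 \<noteq> 0"
  shows "jacobi_germ k (2 * r)
    (\<lambda>w. 2 * s (w / 2) * c (w / 2) * d (w / 2) / (1 - k\<^sup>2 * s (w / 2) ^ 4))
    (\<lambda>w. ((c (w / 2))\<^sup>2 - (s (w / 2))\<^sup>2 * (d (w / 2))\<^sup>2) / (1 - k\<^sup>2 * s (w / 2) ^ 4))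
    (\<lambda>w. ((d (w / 2))\<^sup>2 - k\<^sup>2 * (s (w / 2))\<^sup>2 * (c (w / 2))\<^sup>2) / (1 - k\<^sup>2 * s (w / 2) ^ 4))"
  unfolding jacobi_germ_def
proof (intro conjI ballI)
  fix w :: complex assume "w \<in> ball 0 (2 * r)"
  then have w: "w / 2 \<in> ball 0 r" by (simp add: norm_divide)
  note gD = jacobi_germD[OF g]
  have half: "((\<lambda>w. w / 2) has_field_derivative 1 / 2) (at w)"
    by (auto intro!: derivative_eq_intros)
  note D = DERIV_chain2[OF gD(5)[OF w] half] DERIV_chain2[OF gD(6)[OF w] half] DERIV_chain2[OF gD(7)[OF w] half]
  define S where "S = s (w / 2)"
  define C where "C = c (w / 2)"
  define E where "E = d (w / 2)"
  note D = D[folded S_def C_def E_def]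
  have rel: "C\<^sup>2 = 1 - S\<^sup>2" "E\<^sup>2 = 1 - k\<^sup>2 * S\<^sup>2"
    using jacobi_germ_squares[OF g w] by (auto simp: S_def C_def E_def)
  have q: "1 - k\<^sup>2 * S ^ 4 \<noteq> 0" using q[OF w] by (simp add: S_def)
  show "((\<lambda>w. 2 * s (w / 2) * c (w / 2) * d (w / 2) / (1 - k\<^sup>2 * s (w / 2) ^ 4)) has_field_derivative
      ((c (w / 2))\<^sup>2 - (s (w / 2))\<^sup>2 * (d (w / 2))\<^sup>2) / (1 - k\<^sup>2 * s (w / 2) ^ 4) *
      (((d (w / 2))\<^sup>2 - k\<^sup>2 * (s (w / 2))\<^sup>2 * (c (w / 2))\<^sup>2) / (1 - k\<^sup>2 * s (w / 2) ^ 4))) (at w)"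
    unfolding S_def[symmetric] C_def[symmetric] E_def[symmetric]
    \<comment> \<open>There remain a nonzero denominator and, once denominators are cleared, a
      polynomial identity modulo the two quadratic relations \<open>rel\<close>.\<close>
    apply (rule derivative_eq_intros D refl)+
    using q apply (simp add: S_def)
    using q apply (simp add: S_def[symmetric] C_def[symmetric] E_def[symmetric] divide_simps)
    using rel apply algebra
    done
  show "((\<lambda>w. ((c (w / 2))\<^sup>2 - (s (w / 2))\<^sup>2 * (d (w / 2))\<^sup>2) / (1 - k\<^sup>2 * s (w / 2) ^ 4)) has_field_derivative
      - (2 * s (w / 2) * c (w / 2) * d (w / 2) / (1 - k\<^sup>2 * s (w / 2) ^ 4) *
      (((d (w / 2))\<^sup>2 - k\<^sup>2 * (s (w / 2))\<^sup>2 * (c (w / 2))\<^sup>2) / (1 - k\<^sup>2 * s (w / 2) ^ 4)))) (at w)"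
    unfolding S_def[symmetric] C_def[symmetric] E_def[symmetric]
    apply (rule derivative_eq_intros D refl)+
    using q apply (simp add: S_def)
    using q apply (simp add: S_def[symmetric] C_def[symmetric] E_def[symmetric] divide_simps)
    using rel apply algebra
    done
  show "((\<lambda>w. ((d (w / 2))\<^sup>2 - k\<^sup>2 * (s (w / 2))\<^sup>2 * (c (w / 2))\<^sup>2) / (1 - k\<^sup>2 * s (w / 2) ^ 4)) has_field_derivative
      - (k\<^sup>2 * (2 * s (w / 2) * c (w / 2) * d (w / 2) / (1 - k\<^sup>2 * s (w / 2) ^ 4)) *
      (((c (w / 2))\<^sup>2 - (s (w / 2))\<^sup>2 * (d (w / 2))\<^sup>2) / (1 - k\<^sup>2 * s (w / 2) ^ 4)))) (at w)"
    unfolding S_def[symmetric] C_def[symmetric] E_def[symmetric]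
    apply (rule derivative_eq_intros D refl)+
    using q apply (simp add: S_def)
    using q apply (simp add: S_def[symmetric] C_def[symmetric] E_def[symmetric] divide_simps)
    using rel apply algebra
    done
qed (use jacobi_germD(1-4)[OF g] in auto)

text \<open>While the two arguments keep the sum \<open>a + b\<close>, the right-hand side stays
  constant. At \<open>t = a\<close> it is the asserted expression; at \<open>t = a + b\<close> the
  second argument is 0 and it reduces to \<open>s (a + b)\<close>.\<close>

lemma jacobi_germ_addition:
  assumes g: "jacobi_germ k r s c d"
    and q: "\<And>v w. v \<in> ball 0 r \<Longrightarrow> w \<in> ball 0 r \<Longrightarrow> 1 - k\<^sup>2 * (s v)\<^sup>2 * (s w)\<^sup>2 \<noteq> 0"
    and ab: "a \<in> ball 0 r" "b \<in> ball 0 r" "a + b \<in> ball 0 r"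
  shows "s (a + b) = (s a * c b * d b + s b * c a * d a) / (1 - k\<^sup>2 * (s a)\<^sup>2 * (s b)\<^sup>2)"
proof -
  note gD = jacobi_germD[OF g]
  define f where "f = (\<lambda>t. (s t * (c (a + b - t) * d (a + b - t)) + s (a + b - t) * (c t * d t))
    / (1 - k\<^sup>2 * (s t)\<^sup>2 * (s (a + b - t))\<^sup>2))"
  have "f a = f (a + b)"
  \<comment> \<open>The intersection is convex and is the set where both \<open>t\<close> and
    \<open>a + b - t\<close> lie in the ball of radius \<open>r\<close>.\<close>
  proof (rule zero_derivative_convex_constant[of "ball 0 r \<inter> ball (a + b) r" f])
    fix t assume "t \<in> ball 0 r \<inter> ball (a + b) r"
    then have t: "t \<in> ball 0 r" "a + b - t \<in> ball 0 r" by (auto simp: dist_norm norm_minus_commute)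
    have sub: "((\<lambda>t. a + b - t) has_field_derivative -1) (at t)"
      by (auto intro!: derivative_eq_intros)
    note D = gD(5)[OF t(1)] gD(6)[OF t(1)] gD(7)[OF t(1)]
      DERIV_chain2[OF gD(5)[OF t(2)] sub] DERIV_chain2[OF gD(6)[OF t(2)] sub] DERIV_chain2[OF gD(7)[OF t(2)] sub]
    define s1 c1 d1 where "s1 = s t" and "c1 = c t" and "d1 = d t"
    define s2 c2 d2 where "s2 = s (a + b - t)" and "c2 = c (a + b - t)" and "d2 = d (a + b - t)"
    note defs = s1_def c1_def d1_def s2_def c2_def d2_def
    note rel = jacobi_germ_squares[OF g t(1)] jacobi_germ_squares[OF g t(2)]
    note rel = rel[folded defs]
    note q = q[OF t, folded defs]
    show "(f has_field_derivative 0) (at t)"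
      unfolding f_def
      apply (rule derivative_eq_intros D refl)+
      using q apply (simp add: defs)
      using q apply (simp add: defs[symmetric] divide_simps)
      using rel apply algebra
      done
  qed (use ab gD(1) in \<open>auto simp: dist_norm intro: convex_Int\<close>)
  then show ?thesis using gD(2-4) by (simp add: f_def mult.assoc)
qed

lemma jacobi_germ_double_formulas:
  assumes g: "jacobi_germ k r s c d" and q: "\<And>w. w \<in> ball 0 r \<Longrightarrow> 1 - k\<^sup>2 * s w ^ 4 \<noteq> 0"
    and w: "2 * w \<in> ball 0 r"
  shows "s (2 * w) = 2 * s w * c w * d w / (1 - k\<^sup>2 * s w ^ 4)"
    and "c (2 * w) = ((c w)\<^sup>2 - (s w)\<^sup>2 * (d w)\<^sup>2) / (1 - k\<^sup>2 * s w ^ 4)"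
    and "d (2 * w) = ((d w)\<^sup>2 - k\<^sup>2 * (s w)\<^sup>2 * (c w)\<^sup>2) / (1 - k\<^sup>2 * s w ^ 4)"
proof -
  have r: "0 < r" using jacobi_germD(1)[OF g] .
  note g2 = jacobi_germ_mono[OF jacobi_germ_double[OF g q] r]
  note jacobi_germ_unique[OF g g2 w]
  then show "s (2 * w) = 2 * s w * c w * d w / (1 - k\<^sup>2 * s w ^ 4)"
    "c (2 * w) = ((c w)\<^sup>2 - (s w)\<^sup>2 * (d w)\<^sup>2) / (1 - k\<^sup>2 * s w ^ 4)"
    "d (2 * w) = ((d w)\<^sup>2 - k\<^sup>2 * (s w)\<^sup>2 * (c w)\<^sup>2) / (1 - k\<^sup>2 * s w ^ 4)"
    using r by simp_all
qed

section \<open>A denominator for the germ\<close>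

lemma holomorphic_ball_primitive:
  fixes f :: "complex \<Rightarrow> complex"
  assumes "f holomorphic_on ball 0 r"
  obtains g where "g 0 = 0" "\<And>w. w \<in> ball 0 r \<Longrightarrow> (g has_field_derivative f w) (at w)"
proof -
  obtain g0 where g0: "\<And>t. t \<in> ball 0 r \<Longrightarrow> (g0 has_field_derivative f t) (at t within ball 0 r)"
    using holomorphic_convex_primitive'[OF convex_ball open_ball assms] by metis
  show thesis
  proof (rule that[of "\<lambda>w. g0 w - g0 0"])
    fix w :: complex assume w: "w \<in> ball 0 r"
    then have "(g0 has_field_derivative f w) (at w)"
      using g0[OF w] by (simp add: at_within_open[OF w open_ball])
    then show "((\<lambda>w. g0 w - g0 0) has_field_derivative f w) (at w)"
      by (auto intro!: derivative_eq_intros)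
  qed simp
qed

text \<open>
  \<open>N\<close> is, up to the factor \<open>exp (a w\<^sup>2)\<close>, Jacobi's theta function \<open>\<Theta>\<close>, normalised by
  \<open>(ln N)'' = - k\<^sup>2 s\<^sup>2\<close>.
\<close>
lemma jacobi_germ_denominator:
  assumes g: "jacobi_germ k r s c d" and q: "\<And>w. w \<in> ball 0 r \<Longrightarrow> 1 - k\<^sup>2 * s w ^ 4 \<noteq> 0"
  obtains N where "N holomorphic_on ball 0 r" "N 0 = 1" "\<And>w. N w \<noteq> 0"
    "\<And>w. 2 * w \<in> ball 0 r \<Longrightarrow> N (2 * w) = N w ^ 4 * (1 - k\<^sup>2 * s w ^ 4)"
proof -
  note gD = jacobi_germD[OF g]
  have "(\<lambda>w. - k\<^sup>2 * (s w)\<^sup>2) holomorphic_on ball 0 r"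
    by (intro holomorphic_intros jacobi_germ_holomorphic[OF g])
  \<comment> \<open>\<open>h\<close> will be the logarithmic derivative of \<open>N\<close>, and its
    primitive \<open>G\<close> will be \<open>ln N\<close>; both vanish at 0.\<close>
  then obtain h where h: "h 0 = 0" "\<And>w. w \<in> ball 0 r \<Longrightarrow> (h has_field_derivative - k\<^sup>2 * (s w)\<^sup>2) (at w)"
    by (rule holomorphic_ball_primitive) blast
  then have "h holomorphic_on ball 0 r" unfolding holomorphic_on_open[OF open_ball] by blast
  then obtain G where G: "G 0 = 0" "\<And>w. w \<in> ball 0 r \<Longrightarrow> (G has_field_derivative h w) (at w)"
    by (rule holomorphic_ball_primitive) blast
  then have Gh: "G holomorphic_on ball 0 r" unfolding holomorphic_on_open[OF open_ball] by blast
  have half: "0 \<in> ball (0::complex) (r / 2)" using gD(1) by simp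
  have double: "((\<lambda>w. 2 * w) has_field_derivative 2) (at w)" for w :: complex
    by (auto intro!: derivative_eq_intros)
  \<comment> \<open>This is the logarithmic derivative of the desired rule for
    \<open>N (2 * w)\<close>. Differentiating once more turns \<open>h\<close> into
    \<open>s^2\<close> at \<open>w\<close> and \<open>2 * w\<close>, where the duplication formula
    applies.\<close>
  have J: "2 * h (2 * w) - 4 * h w = - 4 * k\<^sup>2 * s w ^ 3 * c w * d w / (1 - k\<^sup>2 * s w ^ 4)"
    if w: "w \<in> ball 0 (r / 2)" for w
  proof -
    define J where "J = (\<lambda>w. 2 * h (2 * w) - 4 * h w + 4 * k\<^sup>2 * (s w ^ 3 * c w * d w / (1 - k\<^sup>2 * s w ^ 4)))"
    have "J w = J 0"
    proof (rule zero_derivative_convex_constant[of "ball 0 (r / 2)" J])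
      fix w :: complex assume "w \<in> ball 0 (r / 2)"
      then have w: "2 * w \<in> ball 0 r" "w \<in> ball 0 r"
        using norm_ge_zero[of w] by (auto simp: norm_mult simp del: norm_ge_zero)
      \<comment> \<open>Only even powers of \<open>s\<close>, \<open>c\<close>, \<open>d\<close>
        survive, so the derivative of \<open>J\<close> is a rational function of \<open>x\<close>
        alone.\<close>
      define x where "x = (s w)\<^sup>2"
      define Q where "Q = 1 - k\<^sup>2 * x\<^sup>2"
      have s4: "s w ^ 4 = x\<^sup>2" by (simp add: x_def flip: power_mult)
      have rel: "(c w)\<^sup>2 = 1 - x" "(d w)\<^sup>2 = 1 - k\<^sup>2 * x"
        using jacobi_germ_squares[OF g w(2)] by (simp_all add: x_def)
      have Q: "1 - k\<^sup>2 * s w ^ 4 = Q" "Q \<noteq> 0" using q[OF w(2)] by (simp_all add: s4 Q_def)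
      have s2: "(s (2 * w))\<^sup>2 = 4 * x * (1 - x) * (1 - k\<^sup>2 * x) / Q\<^sup>2"
      proof -
        have "s (2 * w) = 2 * s w * c w * d w / Q"
          using jacobi_germ_double_formulas(1)[OF g q w(1)] Q(1) by simp
        then show ?thesis by (simp add: power_divide power_mult_distrib rel flip: x_def)
      qed
      have num: "((\<lambda>w. s w ^ 3 * c w * d w) has_field_derivative
          3 * x * (1 - x) * (1 - k\<^sup>2 * x) - x\<^sup>2 * (1 - k\<^sup>2 * x) - k\<^sup>2 * x\<^sup>2 * (1 - x)) (at w)"
        by (rule derivative_eq_intros gD(5-7)[OF w(2)] refl)+ (simp, use rel x_def in algebra)
      have den: "((\<lambda>w. 1 - k\<^sup>2 * s w ^ 4) has_field_derivative - 4 * k\<^sup>2 * s w ^ 3 * c w * d w) (at w)"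
        by (rule derivative_eq_intros gD(5)[OF w(2)] refl)+ simp
      have prod: "(s w ^ 3 * c w * d w) * (- 4 * k\<^sup>2 * s w ^ 3 * c w * d w)
          = - 4 * k\<^sup>2 * x ^ 3 * (1 - x) * (1 - k\<^sup>2 * x)"
        using rel x_def by algebra
      have "((\<lambda>w. s w ^ 3 * c w * d w / (1 - k\<^sup>2 * s w ^ 4)) has_field_derivative
          ((3 * x * (1 - x) * (1 - k\<^sup>2 * x) - x\<^sup>2 * (1 - k\<^sup>2 * x) - k\<^sup>2 * x\<^sup>2 * (1 - x)) * Q
            + 4 * k\<^sup>2 * x ^ 3 * (1 - x) * (1 - k\<^sup>2 * x)) / (Q * Q)) (at w)"
        using DERIV_divide[OF num den] Q(2) unfolding prod Q(1) by simp
      note D = DERIV_cmult[OF this, of "4 * k\<^sup>2"] DERIV_cmult[OF DERIV_chain2[OF h(2)[OF w(1)] double], of 2]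
        DERIV_cmult[OF h(2)[OF w(2)], of 4]
      have "(J has_field_derivative 2 * (- k\<^sup>2 * (4 * x * (1 - x) * (1 - k\<^sup>2 * x) / Q\<^sup>2) * 2) - 4 * (- k\<^sup>2 * x)
          + 4 * k\<^sup>2 * (((3 * x * (1 - x) * (1 - k\<^sup>2 * x) - x\<^sup>2 * (1 - k\<^sup>2 * x) - k\<^sup>2 * x\<^sup>2 * (1 - x)) * Q
            + 4 * k\<^sup>2 * x ^ 3 * (1 - x) * (1 - k\<^sup>2 * x)) / (Q * Q))) (at w)"
        using DERIV_add[OF DERIV_diff[OF D(2,3)] D(1)] unfolding J_def s2 x_def[symmetric]
        by (simp only: mult.assoc times_divide_eq_right)
      moreover have "2 * (- k\<^sup>2 * (4 * x * (1 - x) * (1 - k\<^sup>2 * x) / Q\<^sup>2) * 2) - 4 * (- k\<^sup>2 * x)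
          + 4 * k\<^sup>2 * (((3 * x * (1 - x) * (1 - k\<^sup>2 * x) - x\<^sup>2 * (1 - k\<^sup>2 * x) - k\<^sup>2 * x\<^sup>2 * (1 - x)) * Q
            + 4 * k\<^sup>2 * x ^ 3 * (1 - x) * (1 - k\<^sup>2 * x)) / (Q * Q)) = 0"
        using Q(2) by (simp add: divide_simps) (use Q_def in algebra)
      ultimately show "(J has_field_derivative 0) (at w)" by simp
    qed (use w half in auto)
    then have "J w = 0" by (simp add: J_def h(1) gD(2))
    then show ?thesis by (simp add: J_def add_eq_0_iff2)
  qed
  \<comment> \<open>Second integration: the quotient of the two sides has derivative 0 by
    \<open>J\<close> and equals 1 at 0.\<close>
  have M: "exp (G (2 * w)) = exp (G w) ^ 4 * (1 - k\<^sup>2 * s w ^ 4)" if w: "w \<in> ball 0 (r / 2)" for w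
  proof -
    define M where "M = (\<lambda>w. exp (G (2 * w) - 4 * G w) / (1 - k\<^sup>2 * s w ^ 4))"
    have "M w = M 0"
    proof (rule zero_derivative_convex_constant[of "ball 0 (r / 2)" M])
      fix w :: complex assume wr: "w \<in> ball 0 (r / 2)"
      then have w: "2 * w \<in> ball 0 r" "w \<in> ball 0 r"
        using norm_ge_zero[of w] by (auto simp: norm_mult simp del: norm_ge_zero)
      have "((\<lambda>w. G (2 * w) - 4 * G w) has_field_derivative 2 * h (2 * w) - 4 * h w) (at w)"
        by (auto intro!: derivative_eq_intros DERIV_chain2[OF G(2)[OF w(1)] double] G(2)[OF w(2)])
      then have num: "((\<lambda>w. exp (G (2 * w) - 4 * G w)) has_field_derivative
          exp (G (2 * w) - 4 * G w) * (- 4 * k\<^sup>2 * s w ^ 3 * c w * d w / (1 - k\<^sup>2 * s w ^ 4))) (at w)"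
        unfolding J[OF wr] by (rule DERIV_chain2[OF DERIV_exp])
      have den: "((\<lambda>w. 1 - k\<^sup>2 * s w ^ 4) has_field_derivative - 4 * k\<^sup>2 * s w ^ 3 * c w * d w) (at w)"
        by (rule derivative_eq_intros gD(5)[OF w(2)] refl)+ simp
      show "(M has_field_derivative 0) (at w)"
        using DERIV_divide[OF num den q[OF w(2)]] q[OF w(2)] unfolding M_def by simp
    qed (use w half in auto)
    then have "M w = 1" by (simp add: M_def G(1) gD(2))
    moreover have "1 - k\<^sup>2 * s w ^ 4 \<noteq> 0" using w gD(1) by (intro q) auto
    ultimately have "exp (G (2 * w) - 4 * G w) = 1 - k\<^sup>2 * s w ^ 4" by (simp add: M_def)
    moreover have "exp (G (2 * w)) = exp (G w) ^ 4 * exp (G (2 * w) - 4 * G w)"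
      by (simp add: exp_diff exp_of_nat_mult[of 4, simplified])
    ultimately show ?thesis by simp
  qed
  show thesis
  \<comment> \<open>An exponential has no zeros, so \<open>N w \<noteq> 0\<close> holds even outside
    the ball, where nothing is known about \<open>G\<close>.\<close>
  proof (rule that[of "\<lambda>w. exp (G w)"])
    fix w :: complex assume "2 * w \<in> ball 0 r"
    then show "exp (G (2 * w)) = exp (G w) ^ 4 * (1 - k\<^sup>2 * s w ^ 4)"
      by (intro M) (simp add: norm_mult)
  qed (use Gh G(1) in \<open>auto intro: holomorphic_intros\<close>)
qed

section \<open>Extension to entire functions\<close>

text \<open>The duplication formulas for \<open>S / N\<close>, \<open>C / N\<close>,
  \<open>D / N\<close>, with numerators and denominator scaled by \<open>N ^ 4\<close>. Being
  polynomial, the map can be iterated across poles.\<close>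

definition jacobi_duplication ::
  "complex \<Rightarrow> complex \<times> complex \<times> complex \<times> complex \<Rightarrow> complex \<times> complex \<times> complex \<times> complex" where
  "jacobi_duplication k = (\<lambda>(S, C, D, N).
     (2 * S * C * D * N, C\<^sup>2 * N\<^sup>2 - S\<^sup>2 * D\<^sup>2, D\<^sup>2 * N\<^sup>2 - k\<^sup>2 * S\<^sup>2 * C\<^sup>2, N ^ 4 - k\<^sup>2 * S ^ 4))"

text \<open>
  The last conjunct excludes common zeros in a form that duplication preserves for every
  \<open>k \<noteq> 0\<close>: if \<open>k\<^sup>2 = 1\<close>, the nonzero quadruple \<open>(1, 0, 0, 1)\<close> is mapped to 0.
\<close>
definition jacobi_quadruple :: "complex \<Rightarrow> complex \<times> complex \<times> complex \<times> complex \<Rightarrow> bool" where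
  "jacobi_quadruple k = (\<lambda>(S, C, D, N).
     C\<^sup>2 = N\<^sup>2 - S\<^sup>2 \<and> D\<^sup>2 = N\<^sup>2 - k\<^sup>2 * S\<^sup>2 \<and> (C \<noteq> 0 \<or> D \<noteq> 0))"

text \<open>If both middle components of the image vanished, so would their difference
  \<open>2 * (k^2 - 1) * S^2 * N^2\<close>. Each way for this product to vanish forces
  \<open>C = D = 0\<close>; the case \<open>N = 0\<close> relies on
  \<open>k \<noteq> 0\<close>.\<close>

lemma jacobi_quadruple_duplication:
  assumes "k \<noteq> 0" "jacobi_quadruple k p"
  shows "jacobi_quadruple k (jacobi_duplication k p)"
proof -
  obtain S C D N where p: "p = (S, C, D, N)" by (cases p) auto
  have h: "C\<^sup>2 = N\<^sup>2 - S\<^sup>2" "D\<^sup>2 = N\<^sup>2 - k\<^sup>2 * S\<^sup>2" "C \<noteq> 0 \<or> D \<noteq> 0"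
    using assms(2) by (auto simp: p jacobi_quadruple_def)
  have "C\<^sup>2 * N\<^sup>2 - S\<^sup>2 * D\<^sup>2 \<noteq> 0 \<or> D\<^sup>2 * N\<^sup>2 - k\<^sup>2 * S\<^sup>2 * C\<^sup>2 \<noteq> 0"
  proof (rule ccontr)
    assume "\<not> ?thesis"
    then have z: "C\<^sup>2 * N\<^sup>2 - S\<^sup>2 * D\<^sup>2 = 0" "D\<^sup>2 * N\<^sup>2 - k\<^sup>2 * S\<^sup>2 * C\<^sup>2 = 0" by auto
    then have "(k\<^sup>2 - 1) * (S * N)\<^sup>2 * 2 = 0" using h(1,2) by algebra
    then consider "k\<^sup>2 = 1" | "S = 0" | "N = 0" by auto
    then show False
    proof cases
      case 1
      then have "D\<^sup>2 = C\<^sup>2" "C ^ 4 = 0" using h(1,2) z by algebra+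
      then show False using h(3) by auto
    next
      case 2
      then have "N ^ 4 = 0" using z h(1,2) by algebra
      then show False using h 2 by auto
    next
      case 3
      then have "k\<^sup>2 * S ^ 4 = 0" using z h(1,2) by algebra
      then show False using h 3 assms(1) by auto
    qed
  qed
  moreover have "(C\<^sup>2 * N\<^sup>2 - S\<^sup>2 * D\<^sup>2)\<^sup>2 = (N ^ 4 - k\<^sup>2 * S ^ 4)\<^sup>2 - (2 * S * C * D * N)\<^sup>2"
    "(D\<^sup>2 * N\<^sup>2 - k\<^sup>2 * S\<^sup>2 * C\<^sup>2)\<^sup>2 = (N ^ 4 - k\<^sup>2 * S ^ 4)\<^sup>2 - k\<^sup>2 * (2 * S * C * D * N)\<^sup>2"
    using h(1,2) by algebra+
  ultimately show ?thesis by (simp add: p jacobi_quadruple_def jacobi_duplication_def)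
qed

lemma jacobi_quadruple_funpow:
  assumes "k \<noteq> 0" "jacobi_quadruple k p"
  shows "jacobi_quadruple k ((jacobi_duplication k ^^ n) p)"
  by (induction n) (simp_all add: assms jacobi_quadruple_duplication)

definition holomorphic_quadruple ::
  "(complex \<Rightarrow> complex \<times> complex \<times> complex \<times> complex) \<Rightarrow> complex set \<Rightarrow> bool" where
  "holomorphic_quadruple F A \<longleftrightarrow> (\<lambda>z. fst (F z)) holomorphic_on A \<and>
     (\<lambda>z. fst (snd (F z))) holomorphic_on A \<and> (\<lambda>z. fst (snd (snd (F z)))) holomorphic_on A \<and>
     (\<lambda>z. snd (snd (snd (F z)))) holomorphic_on A"

lemma holomorphic_quadruple_funpow:
  assumes "holomorphic_quadruple F A"
  shows "holomorphic_quadruple (\<lambda>z. (jacobi_duplication k ^^ n) (F z)) A"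
proof (induction n)
  case (Suc n)
  then show ?case
    by (auto simp: holomorphic_quadruple_def jacobi_duplication_def case_prod_unfold
        intro!: holomorphic_intros)
qed (use assms in simp)

lemma holomorphic_quadruple_scale:
  assumes F: "holomorphic_quadruple F A" and "\<And>z. z \<in> B \<Longrightarrow> z / a \<in> A" "a \<noteq> 0"
  shows "holomorphic_quadruple (\<lambda>z. F (z / a)) B"
proof -
  have "(\<lambda>z. f (z / a)) holomorphic_on B" if "f holomorphic_on A" for f
    by (rule holomorphic_on_compose_gen[OF _ that, unfolded o_def])
      (use assms in \<open>auto intro!: holomorphic_intros\<close>)
  from this[of "\<lambda>z. fst (F z)"] this[of "\<lambda>z. fst (snd (F z))"] this[of "\<lambda>z. fst (snd (snd (F z)))"]
    this[of "\<lambda>z. snd (snd (snd (F z)))"]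
  show ?thesis using F by (auto simp: holomorphic_quadruple_def)
qed

text \<open>One more halving of the argument is undone by one more application of \<open>P\<close>,
  so the value is the same for all \<open>n\<close> that bring \<open>z / 2 ^ n\<close> into the
  ball.\<close>

lemma dilation_extension:
  fixes f :: "complex \<Rightarrow> 'a" and P :: "'a \<Rightarrow> 'a"
  assumes "0 < r" and dup: "\<And>w. 2 * w \<in> ball 0 r \<Longrightarrow> f (2 * w) = P (f w)"
  obtains F where "\<And>n z. norm z < 2 ^ n * r \<Longrightarrow> F z = (P ^^ n) (f (z / 2 ^ n))"
proof -
  \<comment> \<open>\<open>F\<close> is built with the least admissible exponent;
    \<open>step\<close> compares it with any other.\<close>
  define m where "m = (\<lambda>z::complex. LEAST n. norm z < 2 ^ n * r)"
  have step: "(P ^^ (n + j)) (f (z / 2 ^ (n + j))) = (P ^^ n) (f (z / 2 ^ n))"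
    if "norm z < 2 ^ n * r" for n j and z :: complex
  proof (induction j)
    case (Suc j)
    have "norm z < 2 ^ (n + j) * r"
      using that by (rule less_le_trans) (use assms(1) in \<open>auto intro!: mult_right_mono power_increasing\<close>)
    then have "f (2 * (z / 2 ^ Suc (n + j))) = P (f (z / 2 ^ Suc (n + j)))"
      by (intro dup) (simp add: norm_divide norm_power field_simps)
    then have "P (f (z / 2 ^ Suc (n + j))) = f (z / 2 ^ (n + j))" by simp
    then have "(P ^^ Suc (n + j)) (f (z / 2 ^ Suc (n + j))) = (P ^^ (n + j)) (f (z / 2 ^ (n + j)))"
      by (simp only: funpow_Suc_right o_apply)
    then show ?case using Suc by simp
  qed simp
  show thesis
  proof (rule that)
    fix n :: nat and z :: complex
    assume z: "norm z < 2 ^ n * r"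
    have "m z \<le> n" "norm z < 2 ^ m z * r"
      using z unfolding m_def by (auto intro: Least_le LeastI)
    then show "(P ^^ m z) (f (z / 2 ^ m z)) = (P ^^ n) (f (z / 2 ^ n))"
      using step[of z "m z" "n - m z"] by simp
  qed
qed

lemma jacobi_germ_cong:
  assumes g: "jacobi_germ k r s c d"
    and eq: "\<And>w. w \<in> ball 0 r \<Longrightarrow> s' w = s w" "\<And>w. w \<in> ball 0 r \<Longrightarrow> c' w = c w"
      "\<And>w. w \<in> ball 0 r \<Longrightarrow> d' w = d w"
  shows "jacobi_germ k r s' c' d'"
proof -
  note gD = jacobi_germD[OF g]
  have tr: "(f' has_field_derivative D) (at w)"
    if "(f has_field_derivative D) (at w)" "w \<in> ball 0 r" "\<And>w. w \<in> ball 0 r \<Longrightarrow> f' w = f w"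
    for f f' :: "complex \<Rightarrow> complex" and w D
    by (rule has_field_derivative_transform_within_open[OF that(1) open_ball that(2)]) (simp add: that(3))
  have 0: "0 \<in> ball (0::complex) r" using gD(1) by simp
  show ?thesis unfolding jacobi_germ_def
    using gD(1-4) eq[OF 0] by (auto simp: eq simp del: mem_ball intro!: tr[where f' = s'] tr[where f' = c'] tr[where f' = d'] gD(5-7))
qed

text \<open>Reflection in 0 preserves the initial value problem, so parity follows from
  uniqueness.\<close>

lemma jacobi_germ_odd_even:
  assumes g: "jacobi_germ k r s c d" and w: "w \<in> ball 0 r"
  shows "s (- w) = - s w" "c (- w) = c w" "d (- w) = d w"
proof -
  note gD = jacobi_germD[OF g]
  have "jacobi_germ k r (\<lambda>w. - s (- w)) (\<lambda>w. c (- w)) (\<lambda>w. d (- w))"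
    unfolding jacobi_germ_def
  proof (intro conjI ballI)
    fix w :: complex assume "w \<in> ball 0 r"
    then have w: "- w \<in> ball 0 r" by simp
    have neg: "((\<lambda>w. - w) has_field_derivative - 1) (at w)" by (auto intro!: derivative_eq_intros)
    show "((\<lambda>w. - s (- w)) has_field_derivative c (- w) * d (- w)) (at w)"
      using DERIV_minus[OF DERIV_chain2[OF gD(5)[OF w] neg]] by simp
    show "((\<lambda>w. c (- w)) has_field_derivative - (- s (- w) * d (- w))) (at w)"
      using DERIV_chain2[OF gD(6)[OF w] neg] by simp
    show "((\<lambda>w. d (- w)) has_field_derivative - (k\<^sup>2 * - s (- w) * c (- w))) (at w)"
      using DERIV_chain2[OF gD(7)[OF w] neg] by simp
  qed (use gD(1-4) in auto)
  from jacobi_germ_unique[OF g this w]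
  show "s (- w) = - s w" "c (- w) = c w" "d (- w) = d w" by simp_all
qed

lemma jacobi_germ_exists_small:
  obtains r s c d where "jacobi_germ k r s c d"
    "\<And>v w. v \<in> ball 0 r \<Longrightarrow> w \<in> ball 0 r \<Longrightarrow> 1 - k\<^sup>2 * (s v)\<^sup>2 * (s w)\<^sup>2 \<noteq> 0"
proof -
  obtain r0 s c d where g: "jacobi_germ k r0 s c d" using jacobi_germ_exists by blast
  note gD = jacobi_germD[OF g]
  \<comment> \<open>Values of \<open>s\<close> below this bound give
    \<open>|k * s v * s w| < 1\<close>, hence a nonzero denominator. The added 1 covers
    \<open>k = 0\<close> and keeps \<delta> at most 1.\<close>
  define \<delta> where "\<delta> = 1 / (1 + norm k)"
  have \<delta>: "0 < \<delta>" "norm k * \<delta> < 1" "\<delta> \<le> 1" unfolding \<delta>_def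
    by (auto simp: divide_simps add_pos_nonneg)
  have "isCont s 0" using gD(1) by (intro DERIV_isCont[OF gD(5)]) simp
  then have "(s \<longlongrightarrow> 0) (nhds 0)" using gD(2) by (simp add: isCont_def tendsto_nhds_iff)
  then have "\<forall>\<^sub>F w in nhds 0. norm (s w) < \<delta>" using tendstoD[OF _ \<delta>(1)] by fastforce
  then obtain e where e: "0 < e" "\<And>w. norm w < e \<Longrightarrow> norm (s w) < \<delta>"
    by (auto simp: eventually_nhds_metric)
  define r where "r = min r0 e"
  have g': "jacobi_germ k r s c d" using gD(1) e(1) by (intro jacobi_germ_mono[OF g]) (auto simp: r_def)
  show thesis
  proof (rule that[OF g'])
    fix v w :: complex assume "v \<in> ball 0 r" "w \<in> ball 0 r"
    then have vw: "norm (s v) < \<delta>" "norm (s w) < \<delta>" by (auto intro!: e(2) simp: r_def)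
    have "norm (s v) * norm (s w) \<le> \<delta> * 1"
      using vw \<delta> by (intro mult_mono) auto
    then have "norm k * (norm (s v) * norm (s w)) \<le> norm k * \<delta>"
      by (intro mult_left_mono) auto
    then have "norm (k * (s v * s w)) < 1" using \<delta> by (simp add: norm_mult)
    then have "norm ((k * (s v * s w))\<^sup>2) < 1" unfolding norm_power by (simp add: abs_square_less_1)
    then have "(k * (s v * s w))\<^sup>2 \<noteq> 1" by auto
    then show "1 - k\<^sup>2 * (s v)\<^sup>2 * (s w)\<^sup>2 \<noteq> 0" by (simp add: power_mult_distrib mult.assoc)
  qed
qed

text \<open>Global numerators and a global denominator, tied to the germ at 0. Identities are
  checked on the ball, where \<open>N\<close> has no zeros, and spread by the identity
  theorem.\<close>

locale jacobi_entire =
  fixes k :: complex and r :: real and S C D N :: "complex \<Rightarrow> complex"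
  assumes modulus_nonzero: "k \<noteq> 0"
    and entire: "S holomorphic_on UNIV" "C holomorphic_on UNIV" "D holomorphic_on UNIV" "N holomorphic_on UNIV"
    and quadruple: "\<And>z. jacobi_quadruple k (S z, C z, D z, N z)"
    and N_nonzero: "\<And>w. w \<in> ball 0 r \<Longrightarrow> N w \<noteq> 0"
    and germ: "jacobi_germ k r (\<lambda>w. S w / N w) (\<lambda>w. C w / N w) (\<lambda>w. D w / N w)"
    and small: "\<And>v w. v \<in> ball 0 r \<Longrightarrow> w \<in> ball 0 r \<Longrightarrow> 1 - k\<^sup>2 * (S v / N v)\<^sup>2 * (S w / N w)\<^sup>2 \<noteq> 0"

lemma jacobi_entire_exists:
  assumes "k \<noteq> 0"
  shows "\<exists>r S C D N. jacobi_entire k r S C D N"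
proof -
  obtain r s c d where g: "jacobi_germ k r s c d"
    and small: "\<And>v w. v \<in> ball 0 r \<Longrightarrow> w \<in> ball 0 r \<Longrightarrow> 1 - k\<^sup>2 * (s v)\<^sup>2 * (s w)\<^sup>2 \<noteq> 0"
    by (rule jacobi_germ_exists_small[of k]) blast
  have q: "1 - k\<^sup>2 * s w ^ 4 \<noteq> 0" if "w \<in> ball 0 r" for w
    using small[OF that that] by (simp add: mult.assoc flip: power_add)
  have r: "0 < r" using jacobi_germD(1)[OF g] .
  obtain N where N: "N holomorphic_on ball 0 r" "N 0 = 1" "\<And>w. N w \<noteq> 0"
    "\<And>w. 2 * w \<in> ball 0 r \<Longrightarrow> N (2 * w) = N w ^ 4 * (1 - k\<^sup>2 * s w ^ 4)"
    using jacobi_germ_denominator[OF g q] by metis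
  define f where "f = (\<lambda>w. (s w * N w, c w * N w, d w * N w, N w))"
  have "f (2 * w) = jacobi_duplication k (f w)" if w: "2 * w \<in> ball 0 r" for w
  proof -
    have "w \<in> ball 0 r" using w norm_ge_zero[of w] by (auto simp: norm_mult simp del: norm_ge_zero)
    then have "1 - k\<^sup>2 * s w ^ 4 \<noteq> 0" by (rule q)
    then show ?thesis
      unfolding f_def jacobi_germ_double_formulas[OF g q w, simplified] N(4)[OF w] jacobi_duplication_def
      by (simp add: divide_simps) (auto simp: algebra_simps power2_eq_square power4_eq_xxxx)
  qed
  then obtain F where F: "\<And>n z. norm z < 2 ^ n * r \<Longrightarrow> F z = (jacobi_duplication k ^^ n) (f (z / 2 ^ n))"
    using dilation_extension[OF r, of f "jacobi_duplication k"] by metis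
  have level: "\<exists>n. norm z < 2 ^ n * r" for z :: complex
    using real_arch_pow[of 2 "norm z / r"] r by (auto simp: field_simps)
  have quad: "jacobi_quadruple k (F z)" for z
  proof -
    obtain n where n: "norm z < 2 ^ n * r" using level by blast
    then have "z / 2 ^ n \<in> ball 0 r" by (simp add: norm_divide norm_power field_simps)
    note sq = jacobi_germ_squares[OF g this]
    \<comment> \<open>A common zero would give \<open>s^2 = 1\<close> and
      \<open>k^2 * s^2 = 1\<close>, hence \<open>k^2 * s^4 = 1\<close>, which the choice of the
      radius excludes.\<close>
    have "c w \<noteq> 0 \<or> d w \<noteq> 0" if "w \<in> ball 0 r" for w
    proof (rule ccontr)
      assume "\<not> ?thesis"
      then have z: "c w = 0" "d w = 0" by auto
      then have "(s w)\<^sup>2 = 1" "k\<^sup>2 * (s w)\<^sup>2 = 1" using jacobi_germ_squares[OF g that] by auto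
      then have "1 - k\<^sup>2 * s w ^ 4 = 0" by algebra
      then show False using q[OF that] by simp
    qed
    from this[OF \<open>z / 2 ^ n \<in> ball 0 r\<close>] have "jacobi_quadruple k (f (z / 2 ^ n))"
      unfolding f_def jacobi_quadruple_def
      by (simp add: power_mult_distrib sq left_diff_distrib N(3))
    then show ?thesis unfolding F[OF n] by (rule jacobi_quadruple_funpow[OF assms])
  qed
  \<comment> \<open>On each of these balls a single \<open>n\<close> serves all \<open>z\<close>, so
    \<open>F\<close> is a polynomial map applied to a rescaled germ; the balls exhaust the
    plane.\<close>
  have hol: "holomorphic_quadruple F (ball 0 (2 ^ n * r))" for n
  proof -
    have F': "F z = (jacobi_duplication k ^^ n) (f (z / 2 ^ n))" if "z \<in> ball 0 (2 ^ n * r)" for z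
      using F that by simp
    have "holomorphic_quadruple f (ball 0 r)"
      unfolding holomorphic_quadruple_def f_def
      by (auto intro!: holomorphic_intros jacobi_germ_holomorphic[OF g] N(1))
    then have "holomorphic_quadruple (\<lambda>z. (jacobi_duplication k ^^ n) (f (z / 2 ^ n))) (ball 0 (2 ^ n * r))"
      by (intro holomorphic_quadruple_funpow holomorphic_quadruple_scale)
        (auto simp: norm_divide norm_power field_simps)
    then show ?thesis
      by (simp add: holomorphic_quadruple_def F' del: mem_ball mem_ball_0 cong: holomorphic_cong)
  qed
  have entire: "h holomorphic_on UNIV" if "\<And>n. h holomorphic_on ball 0 (2 ^ n * r)" for h :: "complex \<Rightarrow> complex"
  proof -
    have "h field_differentiable (at z)" for z
    proof -
      obtain n where "norm z < 2 ^ n * r" using level by blast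
      then show ?thesis by (intro holomorphic_on_imp_differentiable_at[OF that[of n]]) auto
    qed
    then show ?thesis by (simp add: holomorphic_on_def)
  qed
  have Ff: "F w = f w" if "w \<in> ball 0 r" for w using F[of w 0] that by simp
  show ?thesis
  proof (intro exI)
    show "jacobi_entire k r (\<lambda>z. fst (F z)) (\<lambda>z. fst (snd (F z))) (\<lambda>z. fst (snd (snd (F z))))
      (\<lambda>z. snd (snd (snd (F z))))"
    proof
      show "jacobi_germ k r (\<lambda>w. fst (F w) / snd (snd (snd (F w)))) (\<lambda>w. fst (snd (F w)) / snd (snd (snd (F w))))
        (\<lambda>w. fst (snd (snd (F w))) / snd (snd (snd (F w))))"
        by (rule jacobi_germ_cong[OF g]) (simp_all add: Ff f_def N(3) del: mem_ball)
    qed (use assms hol quad N(3) small in \<open>auto simp: holomorphic_quadruple_def Ff f_def simp del: mem_ball intro!: entire\<close>)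
  qed
qed

section \<open>The Jacobi functions as quotients\<close>

text \<open>\<open>G a \<noteq> 0\<close> makes the zeros of \<open>G\<close> isolated, and a
  nonvanishing numerator makes each of them a pole. There division by zero gives the value 0, which
  is what \<open>nicely_meromorphic_on\<close> prescribes at poles.\<close>

lemma nicely_meromorphic_quotient:
  assumes hol: "F holomorphic_on UNIV" "G holomorphic_on UNIV"
    and "G a \<noteq> 0" and F: "\<And>z. G z = 0 \<Longrightarrow> F z \<noteq> 0"
  shows "(\<lambda>z. F z / G z) nicely_meromorphic_on UNIV" "is_pole (\<lambda>z. F z / G z) z \<longleftrightarrow> G z = 0"
proof -
  have cont: "isCont F z" "isCont G z" for z
    using hol[THEN holomorphic_on_imp_continuous_on] by (auto simp: continuous_on_eq_continuous_at)
  have pole: "is_pole (\<lambda>z. F z / G z) z" if "G z = 0" for z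
  proof (rule is_pole_divide)
    have "\<forall>\<^sub>F w in at z. G w \<noteq> 0"
      using non_zero_neighbour_alt[OF hol(2) open_UNIV connected_UNIV, of z a] assms(3)
      by (auto elim: eventually_mono)
    then show "filterlim G (at 0) (at z)"
      using cont(2)[of z] that by (auto simp: filterlim_at isCont_def)
  qed (use cont F that in auto)
  have nopole: "isCont (\<lambda>z. F z / G z) z" if "G z \<noteq> 0" for z
    using that cont by (intro continuous_intros) auto
  show "is_pole (\<lambda>z. F z / G z) z \<longleftrightarrow> G z = 0"
    using pole nopole by (metis is_pole_def isCont_def not_tendsto_and_filterlim_at_infinity trivial_limit_at)
  have "(\<lambda>z. F z / G z) meromorphic_on UNIV"
    using hol by (intro meromorphic_intros analytic_on_imp_meromorphic_on) (auto simp: analytic_on_open)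
  then show "(\<lambda>z. F z / G z) nicely_meromorphic_on UNIV"
    unfolding nicely_meromorphic_on_def using pole nopole by (auto simp: isCont_def)
qed

text \<open>The difference with its singularities removed vanishes near \<open>a\<close>, hence
  everywhere. So \<open>f\<close> and \<open>g\<close> agree in a punctured neighbourhood of every
  point, and this fixes their values there: 0 at a pole, the limit otherwise.\<close>

lemma nicely_meromorphic_eqI:
  assumes f: "f nicely_meromorphic_on UNIV" and g: "g nicely_meromorphic_on UNIV"
    and eq: "\<forall>\<^sub>F z in at a. f z = g z"
  shows "f = g"
proof
  fix z
  define h where "h = (\<lambda>z. f z - g z)"
  have h: "h meromorphic_on UNIV"
    using f g unfolding h_def nicely_meromorphic_on_def by (auto intro: meromorphic_intros)
  have iso: "isolated_singularity_at h z" for z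
    using meromorphic_on_isolated_singularity[OF meromorphic_on_subset[OF h]] by simp
  have "\<forall>\<^sub>F z in at a. remove_sings h z = 0"
    using eq eventually_remove_sings_eq_at[OF iso[of a]] by eventually_elim (simp add: h_def)
  then have R: "remove_sings h w = 0" for w
    by (intro frequently_eq_meromorphic_imp_constant[of "remove_sings h" 0 a UNIV]
        remove_sings_nicely_meromorphic h eventually_frequently) auto
  have fg: "\<forall>\<^sub>F w in at z. f w = g w"
    using eventually_remove_sings_eq_at[OF iso[of z]] by eventually_elim (simp add: R, simp add: h_def)
  show "f z = g z"
  proof (cases "is_pole f z")
    case True
    then have "is_pole g z" using is_pole_cong[OF fg refl] by simp
    then show ?thesis using True f g by (simp add: is_pole_zero_at_nicely_mero)
  next
    case False
    then have ng: "\<not> is_pole g z" using is_pole_cong[OF fg refl] by simp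
    have "f \<midarrow>z\<rightarrow> f z" "g \<midarrow>z\<rightarrow> g z"
      using f g False ng unfolding nicely_meromorphic_on_def by auto
    then show ?thesis
      using tendsto_cong[OF fg] tendsto_unique[of "at z"] by (metis trivial_limit_at)
  qed
qed

lemma jacobi_triple_germ:
  assumes "jacobi_triple k s c d"
  shows "\<exists>r. jacobi_germ k r s c d"
proof -
  have "\<exists>e>0. f holomorphic_on ball 0 e" if "f analytic_on {0}" for f :: "complex \<Rightarrow> complex"
    using that by (auto simp: analytic_on_def)
  then obtain e1 e2 e3 where e: "e1 > 0" "e2 > 0" "e3 > 0" "s holomorphic_on ball 0 e1"
    "c holomorphic_on ball 0 e2" "d holomorphic_on ball 0 e3"
    using assms unfolding jacobi_triple_def by metis
  define e where "e = min e1 (min e2 e3)"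
  have an: "f analytic_on {w}" if "f holomorphic_on ball 0 e'" "w \<in> ball 0 e'"
    for f :: "complex \<Rightarrow> complex" and w e'
    using that by (meson analytic_at open_ball)
  have "s analytic_on {w}" "c analytic_on {w}" "d analytic_on {w}" if "w \<in> ball 0 e" for w
    by (rule an[OF e(4)] an[OF e(5)] an[OF e(6)], use that in \<open>simp add: e_def\<close>)+
  moreover have "0 < e" using e by (simp add: e_def)
  ultimately have "jacobi_germ k e s c d"
    using assms unfolding jacobi_germ_def jacobi_triple_def by blast
  then show ?thesis by blast
qed

text \<open>The germs at 0 agree by local uniqueness, and the meromorphic identity theorem does the
  rest. Given one triple, the three \<open>THE\<close> terms therefore denote its members.\<close>

lemma jacobi_triple_unique:
  assumes t: "jacobi_triple k s c d" "jacobi_triple k s' c' d'"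
  shows "s = s'" "c = c'" "d = d'"
proof -
  obtain r r' where "jacobi_germ k r s c d" "jacobi_germ k r' s' c' d'"
    using t jacobi_triple_germ by blast
  then have "\<forall>\<^sub>F w in at 0. s w = s' w \<and> c w = c' w \<and> d w = d' w"
    using jacobi_germ_unique_near eventually_nhds_conv_at by metis
  then have "\<forall>\<^sub>F w in at 0. s w = s' w" "\<forall>\<^sub>F w in at 0. c w = c' w" "\<forall>\<^sub>F w in at 0. d w = d' w"
    by (auto elim: eventually_mono)
  then show "s = s'" "c = c'" "d = d'"
    using t unfolding jacobi_triple_def by (blast intro: nicely_meromorphic_eqI)+
qed

lemma jacobi_functions_eq:
  assumes "jacobi_triple k s c d"
  shows "jacobi_sn k = s" "jacobi_cn k = c" "jacobi_dn k = d"
proof -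
  show "jacobi_sn k = s" unfolding jacobi_sn_def
    by (rule the_equality) (use assms jacobi_triple_unique(1) in blast)+
  show "jacobi_cn k = c" unfolding jacobi_cn_def
    by (rule the_equality) (use assms jacobi_triple_unique(2) in blast)+
  show "jacobi_dn k = d" unfolding jacobi_dn_def
    by (rule the_equality) (use assms jacobi_triple_unique(3) in blast)+
qed

lemma holomorphic_eq_on_UNIV:
  assumes "f holomorphic_on UNIV" "g holomorphic_on UNIV" "0 < r"
    and "\<And>w. w \<in> ball 0 r \<Longrightarrow> f w = g w"
  shows "f z = (g z :: complex)"
  by (rule analytic_continuation_open[of "ball 0 r" UNIV f g]) (use assms in auto)

lemma holomorphic_on_compose_entire:
  assumes "f holomorphic_on UNIV" "g holomorphic_on A"
  shows "(\<lambda>z. f (g z)) holomorphic_on A"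
  using holomorphic_on_compose_gen[OF assms(2,1)] by (simp add: o_def)

section \<open>Zeros of the denominator and the differential equations\<close>

context jacobi_entire
begin

lemma radius_pos: "0 < r"
  using jacobi_germD(1)[OF germ] .

text \<open>At a zero of \<open>N\<close> the quadratic relations become \<open>C^2 = - S^2\<close>
  and \<open>D^2 = - k^2 * S^2\<close>, so all three vanish or none does, and
  \<open>jacobi_quadruple\<close> excludes the former. Hence every zero of \<open>N\<close> is a
  pole of all three quotients.\<close>

lemma numerators_nonzero:
  assumes "N z = 0"
  shows "S z \<noteq> 0" "C z \<noteq> 0" "D z \<noteq> 0"
  using quadruple[of z] assms modulus_nonzero by (auto simp: jacobi_quadruple_def)

text \<open>The differential equations of the quotients, multiplied by \<open>N^2\<close>. They hold
  near 0 by the germ and everywhere because both sides are entire.\<close>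

lemma wronskians:
  "deriv S z * N z - S z * deriv N z = C z * D z"
  "deriv C z * N z - C z * deriv N z = - (S z * D z)"
  "deriv D z * N z - D z * deriv N z = - (k\<^sup>2 * S z * C z)"
proof -
  have diff: "(F has_field_derivative deriv F w) (at w)" if "F holomorphic_on UNIV" for F w
    using that by (intro holomorphic_derivI[of _ UNIV]) auto
  have local: "deriv F w * N w - F w * deriv N w = E * (N w)\<^sup>2"
    if "F holomorphic_on UNIV" "((\<lambda>w. F w / N w) has_field_derivative E) (at w)" "w \<in> ball 0 r" for F w E
  proof -
    have "((\<lambda>w. F w / N w) has_field_derivative (deriv F w * N w - F w * deriv N w) / (N w * N w)) (at w)"
      by (intro DERIV_divide diff that entire N_nonzero)
    from DERIV_unique[OF that(2) this] show ?thesis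
      using N_nonzero[OF that(3)] by (simp add: power2_eq_square)
  qed
  have hol: "deriv F holomorphic_on UNIV" if "F holomorphic_on UNIV" for F :: "complex \<Rightarrow> complex"
    using that by (intro holomorphic_deriv) auto
  note gD = jacobi_germD(5-7)[OF germ]
  note ext = holomorphic_eq_on_UNIV[OF _ _ radius_pos]
  show "deriv S z * N z - S z * deriv N z = C z * D z"
    by (rule ext, (intro holomorphic_intros hol entire)+)
      (simp add: local[OF entire(1) gD(1)] N_nonzero power2_eq_square del: mem_ball mem_ball_0)
  show "deriv C z * N z - C z * deriv N z = - (S z * D z)"
    by (rule ext, (intro holomorphic_intros hol entire)+)
      (simp add: local[OF entire(2) gD(2)] N_nonzero power2_eq_square del: mem_ball mem_ball_0)
  show "deriv D z * N z - D z * deriv N z = - (k\<^sup>2 * S z * C z)"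
    by (rule ext, (intro holomorphic_intros hol entire)+)
      (simp add: local[OF entire(3) gD(3)] N_nonzero power2_eq_square del: mem_ball mem_ball_0)
qed

lemma triple: "jacobi_triple k (\<lambda>z. S z / N z) (\<lambda>z. C z / N z) (\<lambda>z. D z / N z)"
proof -
  have N0: "N 0 \<noteq> 0" using radius_pos by (intro N_nonzero) simp
  note mero = nicely_meromorphic_quotient[OF _ entire(4) N0]
  have an: "(\<lambda>z. F z / N z) analytic_on {0}" if "F holomorphic_on UNIV" for F
    using that entire(4) N0 by (intro analytic_intros) (auto simp: analytic_at)
  have deriv: "((\<lambda>z. S z / N z) has_field_derivative C w / N w * (D w / N w)) (at w) \<and>
        ((\<lambda>z. C z / N z) has_field_derivative - (S w / N w * (D w / N w))) (at w) \<and>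
        ((\<lambda>z. D z / N z) has_field_derivative - (k\<^sup>2 * (S w / N w) * (C w / N w))) (at w)"
    if "(\<lambda>z. S z / N z) analytic_on {w}" for w
  proof -
    \<comment> \<open>Analyticity of \<open>S / N\<close> at \<open>w\<close> rules out a pole, so
      \<open>N w\<close> is nonzero and the quotient rule applies to all three functions.\<close>
    have Nw: "N w \<noteq> 0"
      using mero(2)[OF entire(1) numerators_nonzero(1)] analytic_at_imp_no_pole[OF that] by simp
    have "((\<lambda>w. F w / N w) has_field_derivative (deriv F w * N w - F w * deriv N w) / (N w * N w)) (at w)"
      if "F holomorphic_on UNIV" for F
      using that entire(4) by (intro DERIV_divide holomorphic_derivI[of _ UNIV] Nw) auto
    from this[OF entire(1)] this[OF entire(2)] this[OF entire(3)]
    show ?thesis by (simp add: wronskians mult.assoc)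
  qed
  show ?thesis
    unfolding jacobi_triple_def
    using mero(1)[OF entire(1) numerators_nonzero(1)] mero(1)[OF entire(2) numerators_nonzero(2)]
      mero(1)[OF entire(3) numerators_nonzero(3)] an entire deriv jacobi_germD(2-4)[OF germ]
    by auto
qed

lemma jacobi_functions:
  "jacobi_sn k = (\<lambda>z. S z / N z)" "jacobi_cn k = (\<lambda>z. C z / N z)" "jacobi_dn k = (\<lambda>z. D z / N z)"
  using jacobi_functions_eq[OF triple] .

lemma jacobi_regular_iff: "jacobi_regular k w \<longleftrightarrow> N w \<noteq> 0"
proof -
  have "N 0 \<noteq> 0" using radius_pos by (intro N_nonzero) simp
  then show ?thesis
    using nicely_meromorphic_quotient(2)[OF entire(1,4) _ numerators_nonzero(1)]
    by (simp add: jacobi_regular_def jacobi_functions)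
qed

end

section \<open>The difference equation\<close>

text \<open>The neighbours enter only through their sum \<open>p\<close> and product
  \<open>m\<close>, whose denominators \<open>Q\<close> clears. The left side times \<open>Q\<close>
  is \<open>c z * d z * (1 - k^2 * s z ^ 4)\<close> times Euler's biquadratic form in
  \<open>s x\<close> and \<open>s y\<close>, which vanishes.\<close>

lemma jacobi_germ_difference_equation:
  assumes g: "jacobi_germ k r s c d"
    and q: "\<And>v w. v \<in> ball 0 r \<Longrightarrow> w \<in> ball 0 r \<Longrightarrow> 1 - k\<^sup>2 * (s v)\<^sup>2 * (s w)\<^sup>2 \<noteq> 0"
    and dom: "x \<in> ball 0 r" "\<gamma> \<in> ball 0 r" "z \<in> ball 0 r" "x + \<gamma> \<in> ball 0 r"
      "x + \<gamma> + z \<in> ball 0 r" "x + \<gamma> - z \<in> ball 0 r"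
  shows "c \<gamma> * d \<gamma> * (1 - k\<^sup>2 * s z ^ 4) * s x * (s (x + \<gamma> + z) + s (x + \<gamma> - z))
      - c z * d z * (1 - k\<^sup>2 * (s z)\<^sup>2 * (s \<gamma>)\<^sup>2) * (s (x + \<gamma> + z) * s (x + \<gamma> - z) + (s x)\<^sup>2)
      + ((c z)\<^sup>2 - (c \<gamma>)\<^sup>2) * c z * d z * (1 + k\<^sup>2 * (s x)\<^sup>2 * s (x + \<gamma> + z) * s (x + \<gamma> - z)) = 0"
proof -
  define y where "y = x + \<gamma>"
  have y: "y \<in> ball 0 r" "y + z \<in> ball 0 r" "y + - z \<in> ball 0 r" "- z \<in> ball 0 r"
    using dom by (auto simp: y_def)
  define Q where "Q = 1 - k\<^sup>2 * (s y)\<^sup>2 * (s z)\<^sup>2"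
  have Q: "Q \<noteq> 0" unfolding Q_def by (intro q y dom)
  note sq = jacobi_germ_squares[OF g]
  have add: "s (a + b) = (s a * c b * d b + s b * c a * d a) / (1 - k\<^sup>2 * (s a)\<^sup>2 * (s b)\<^sup>2)"
    if "a \<in> ball 0 r" "b \<in> ball 0 r" "a + b \<in> ball 0 r" for a b
    by (rule jacobi_germ_addition[OF g _ that]) (rule q)
  have plus: "s (y + z) * Q = s y * c z * d z + s z * c y * d y"
    using add[OF y(1) dom(3) y(2)] Q by (simp add: Q_def)
  have minus: "s (y - z) * Q = s y * c z * d z - s z * c y * d y"
    using add[OF y(1) y(4) y(3)] Q jacobi_germ_odd_even[OF g dom(3)] by (simp add: Q_def)
  have sum: "(s (y + z) + s (y - z)) * Q = 2 * s y * c z * d z"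
    using plus minus by (simp add: algebra_simps)
  have "s (y + z) * s (y - z) * Q * Q = (s y * c z * d z)\<^sup>2 - (s z * c y * d y)\<^sup>2"
    using plus minus by algebra
  \<comment> \<open>Modulo the quadratic relations the difference of squares contains the factor
    \<open>Q\<close>, so one \<open>Q\<close> cancels.\<close>
  also have "\<dots> = ((s y)\<^sup>2 - (s z)\<^sup>2) * Q"
    using sq[OF y(1)] sq[OF dom(3)] unfolding Q_def by algebra
  finally have prod: "s (y + z) * s (y - z) * Q = (s y)\<^sup>2 - (s z)\<^sup>2"
    using Q by simp
  have "s y * (1 - k\<^sup>2 * (s x)\<^sup>2 * (s \<gamma>)\<^sup>2) = s x * c \<gamma> * d \<gamma> + s \<gamma> * c x * d x"
    using add[OF dom(1,2,4)] q[OF dom(1,2)] by (simp add: y_def)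
  \<comment> \<open>Isolating and squaring the term with \<open>c x * d x\<close> removes these two
    functions; what results is Euler's relation times a nonzero factor.\<close>
  then have "(s y * (1 - k\<^sup>2 * (s x)\<^sup>2 * (s \<gamma>)\<^sup>2) - s x * c \<gamma> * d \<gamma>)\<^sup>2 = (s \<gamma>)\<^sup>2 * (c x)\<^sup>2 * (d x)\<^sup>2"
    by algebra
  then have "(1 - k\<^sup>2 * (s x)\<^sup>2 * (s \<gamma>)\<^sup>2) *
      (2 * c \<gamma> * d \<gamma> * s x * s y + (s \<gamma>)\<^sup>2 - (s y)\<^sup>2 - (s x)\<^sup>2 + k\<^sup>2 * (s \<gamma>)\<^sup>2 * (s y)\<^sup>2 * (s x)\<^sup>2) = 0"
    using sq[OF dom(1)] sq[OF dom(2)] by algebra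
  then have euler: "2 * c \<gamma> * d \<gamma> * s x * s y + (s \<gamma>)\<^sup>2 - (s y)\<^sup>2 - (s x)\<^sup>2
      + k\<^sup>2 * (s \<gamma>)\<^sup>2 * (s y)\<^sup>2 * (s x)\<^sup>2 = 0"
    using q[OF dom(1,2)] by simp
  define p m where "p = s (y + z) + s (y - z)" and "m = s (y + z) * s (y - z)"
  have cc: "(c z)\<^sup>2 - (c \<gamma>)\<^sup>2 = (s \<gamma>)\<^sup>2 - (s z)\<^sup>2"
    using sq(1)[OF dom(2)] sq(1)[OF dom(3)] by simp
  have "Q * (c \<gamma> * d \<gamma> * (1 - k\<^sup>2 * s z ^ 4) * s x * p
      - c z * d z * (1 - k\<^sup>2 * (s z)\<^sup>2 * (s \<gamma>)\<^sup>2) * (m + (s x)\<^sup>2)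
      + ((s \<gamma>)\<^sup>2 - (s z)\<^sup>2) * c z * d z * (1 + k\<^sup>2 * (s x)\<^sup>2 * m)) =
    c \<gamma> * d \<gamma> * (1 - k\<^sup>2 * s z ^ 4) * s x * (p * Q)
      - c z * d z * (1 - k\<^sup>2 * (s z)\<^sup>2 * (s \<gamma>)\<^sup>2) * (m * Q + (s x)\<^sup>2 * Q)
      + ((s \<gamma>)\<^sup>2 - (s z)\<^sup>2) * c z * d z * (Q + k\<^sup>2 * (s x)\<^sup>2 * (m * Q))"
    by (simp add: algebra_simps)
  also have "\<dots> = c z * d z * (1 - k\<^sup>2 * s z ^ 4) *
     (2 * c \<gamma> * d \<gamma> * s x * s y + (s \<gamma>)\<^sup>2 - (s y)\<^sup>2 - (s x)\<^sup>2 + k\<^sup>2 * (s \<gamma>)\<^sup>2 * (s y)\<^sup>2 * (s x)\<^sup>2)"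
    unfolding sum[folded p_def] prod[folded m_def] unfolding Q_def by algebra
  finally show ?thesis
    using Q unfolding euler cc y_def[symmetric] p_def m_def by (simp add: mult.assoc)
qed

section \<open>Continuation of the equation to all arguments\<close>

context jacobi_entire
begin

text \<open>The difference equation with denominators cleared, hence entire in each of its three variables.\<close>

definition cleared_equation :: "complex \<Rightarrow> complex \<Rightarrow> complex \<Rightarrow> complex" where
  "cleared_equation x \<gamma> z =
     C \<gamma> * D \<gamma> * (N z ^ 4 - k\<^sup>2 * S z ^ 4) * S x * N x
         * (S (x + \<gamma> + z) * N (x + \<gamma> - z) + S (x + \<gamma> - z) * N (x + \<gamma> + z))
     - C z * D z * ((N z)\<^sup>2 * (N \<gamma>)\<^sup>2 - k\<^sup>2 * (S z)\<^sup>2 * (S \<gamma>)\<^sup>2)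
         * (S (x + \<gamma> + z) * S (x + \<gamma> - z) * (N x)\<^sup>2 + (S x)\<^sup>2 * N (x + \<gamma> + z) * N (x + \<gamma> - z))
     + ((C z)\<^sup>2 * (N \<gamma>)\<^sup>2 - (C \<gamma>)\<^sup>2 * (N z)\<^sup>2) * C z * D z
         * ((N x)\<^sup>2 * N (x + \<gamma> + z) * N (x + \<gamma> - z) + k\<^sup>2 * (S x)\<^sup>2 * S (x + \<gamma> + z) * S (x + \<gamma> - z))"

lemma cleared_equation_eq:
  fixes x \<gamma> z :: complex
  defines "s \<equiv> \<lambda>w. S w / N w" and "c \<equiv> \<lambda>w. C w / N w" and "d \<equiv> \<lambda>w. D w / N w"
  assumes "N x \<noteq> 0" "N \<gamma> \<noteq> 0" "N z \<noteq> 0" "N (x + \<gamma> + z) \<noteq> 0" "N (x + \<gamma> - z) \<noteq> 0"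
  shows "cleared_equation x \<gamma> z =
    (N \<gamma>)\<^sup>2 * N z ^ 4 * (N x)\<^sup>2 * N (x + \<gamma> + z) * N (x + \<gamma> - z) *
    (c \<gamma> * d \<gamma> * (1 - k\<^sup>2 * s z ^ 4) * s x * (s (x + \<gamma> + z) + s (x + \<gamma> - z))
      - c z * d z * (1 - k\<^sup>2 * (s z)\<^sup>2 * (s \<gamma>)\<^sup>2) * (s (x + \<gamma> + z) * s (x + \<gamma> - z) + (s x)\<^sup>2)
      + ((c z)\<^sup>2 - (c \<gamma>)\<^sup>2) * c z * d z * (1 + k\<^sup>2 * (s x)\<^sup>2 * s (x + \<gamma> + z) * s (x + \<gamma> - z)))"
proof -
  have sub: "S w = s w * N w" "C w = c w * N w" "D w = d w * N w" if "N w \<noteq> 0" for w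
    using that by (simp_all add: s_def c_def d_def)
  show ?thesis
    unfolding cleared_equation_def sub[OF assms(4)] sub[OF assms(5)] sub[OF assms(6)] sub[OF assms(7)] sub[OF assms(8)]
    by algebra
qed

lemma cleared_equation_holomorphic:
  "(\<lambda>x. cleared_equation x \<gamma> z) holomorphic_on UNIV"
  "(\<lambda>\<gamma>. cleared_equation x \<gamma> z) holomorphic_on UNIV"
  "(\<lambda>z. cleared_equation x \<gamma> z) holomorphic_on UNIV"
  unfolding cleared_equation_def
  by (intro holomorphic_intros entire[THEN holomorphic_on_compose_entire])+

text \<open>The identity theorem in one variable suffices: three continuations in succession free
  \<open>z\<close>, then \<gamma>, then \<open>x\<close> from the restriction to a small
  ball.\<close>

lemma cleared_equation_zero: "cleared_equation x \<gamma> z = 0"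
proof -
  \<comment> \<open>Three arguments of modulus below \<open>r / 4\<close> keep
    \<open>x + \<gamma> + z\<close> and \<open>x + \<gamma> - z\<close> inside the ball of radius
    \<open>r\<close>.\<close>
  define e where "e = r / 4"
  have e: "0 < e" using radius_pos by (simp add: e_def)
  have "cleared_equation x \<gamma> z = 0" if "x \<in> ball 0 e" "\<gamma> \<in> ball 0 e" "z \<in> ball 0 e" for x \<gamma> z
  proof -
    have *: "norm (x + \<gamma>) \<le> norm x + norm \<gamma>" "norm (x + \<gamma> + z) \<le> norm x + norm \<gamma> + norm z"
      "norm (x + \<gamma> - z) \<le> norm x + norm \<gamma> + norm z"
      using norm_triangle_ineq[of x \<gamma>] norm_triangle_ineq[of "x + \<gamma>" z] norm_triangle_ineq4[of "x + \<gamma>" z]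
      by linarith+
    then have dom: "x \<in> ball 0 r" "\<gamma> \<in> ball 0 r" "z \<in> ball 0 r" "x + \<gamma> \<in> ball 0 r"
      "x + \<gamma> + z \<in> ball 0 r" "x + \<gamma> - z \<in> ball 0 r"
      using that radius_pos by (auto simp: e_def)
    show ?thesis
      unfolding cleared_equation_eq[OF N_nonzero[OF dom(1)] N_nonzero[OF dom(2)] N_nonzero[OF dom(3)]
          N_nonzero[OF dom(5)] N_nonzero[OF dom(6)]]
      by (intro mult_eq_0_iff[THEN iffD2] disjI2 jacobi_germ_difference_equation[OF germ _ dom] small)
  qed
  then have "cleared_equation x \<gamma> z = 0" if "x \<in> ball 0 e" "\<gamma> \<in> ball 0 e" for x \<gamma> z
    using holomorphic_eq_on_UNIV[OF cleared_equation_holomorphic(3) holomorphic_on_const e] that by blast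
  then have "cleared_equation x \<gamma> z = 0" if "x \<in> ball 0 e" for x \<gamma> z
    using holomorphic_eq_on_UNIV[OF cleared_equation_holomorphic(2) holomorphic_on_const e] that by blast
  then show ?thesis
    using holomorphic_eq_on_UNIV[OF cleared_equation_holomorphic(1) holomorphic_on_const e] by blast
qed

end

text \<open>The five regularity conditions say that the values of \<open>N\<close> in the factor
  relating the cleared equation to this one are nonzero, so the factor can be divided out.\<close>

lemma jacobi_difference_equation:
  assumes "k \<noteq> 0" and "jacobi_regular k x" "jacobi_regular k \<gamma>" "jacobi_regular k z"
    "jacobi_regular k (x + \<gamma> + z)" "jacobi_regular k (x + \<gamma> - z)"
  shows "jacobi_cn k \<gamma> * jacobi_dn k \<gamma> * (1 - k\<^sup>2 * jacobi_sn k z ^ 4) * jacobi_sn k x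
        * (jacobi_sn k (x + \<gamma> + z) + jacobi_sn k (x + \<gamma> - z))
      - jacobi_cn k z * jacobi_dn k z * (1 - k\<^sup>2 * (jacobi_sn k z)\<^sup>2 * (jacobi_sn k \<gamma>)\<^sup>2)
        * (jacobi_sn k (x + \<gamma> + z) * jacobi_sn k (x + \<gamma> - z) + (jacobi_sn k x)\<^sup>2)
      + ((jacobi_cn k z)\<^sup>2 - (jacobi_cn k \<gamma>)\<^sup>2) * jacobi_cn k z * jacobi_dn k z
        * (1 + k\<^sup>2 * (jacobi_sn k x)\<^sup>2 * jacobi_sn k (x + \<gamma> + z) * jacobi_sn k (x + \<gamma> - z)) = 0"
proof -
  obtain r S C D N where "jacobi_entire k r S C D N" using jacobi_entire_exists[OF assms(1)] by blast
  then interpret jacobi_entire k r S C D N .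
  show ?thesis
    using cleared_equation_eq[of x \<gamma> z] cleared_equation_zero[of x \<gamma> z] assms(2-)
    by (simp add: jacobi_regular_iff jacobi_functions)
qed

section \<open>The sequence of arguments of sn\<close>

theorem mainTheorem5:
  fixes k \<alpha>0 \<beta>0 \<phi> \<xi>0 z0 \<gamma>e \<gamma>o :: complex
    and z \<gamma> u x :: "int \<Rightarrow> complex"
    and \<xi> v :: "int \<Rightarrow> int \<Rightarrow> complex"
  assumes "k \<noteq> 0"
    and "z0 = (\<alpha>0 - \<beta>0) / 2"
    and "\<gamma>e = (\<alpha>0 + \<beta>0) / 2"
    and "\<gamma>o = (\<phi> - \<alpha>0 - \<beta>0) / 2"
    and "\<And>n. z n = (\<gamma>e + \<gamma>o) * of_int n + z0"
    and "\<And>n. \<gamma> n = (if even n then \<gamma>e else \<gamma>o)"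
    and "\<And>n. \<xi> n n = \<xi>0 + of_int n * (\<alpha>0 - \<beta>0) + of_int (n * (n - 1)) * \<phi>"
    and "\<And>n. \<xi> n (n + 1) = \<xi>0 - \<beta>0 + of_int n * (\<alpha>0 - \<beta>0) + of_int (n\<^sup>2) * \<phi>"
    and "\<And>n. v n n = csqrt k * jacobi_sn k (\<xi> n n)"
    and "\<And>n. v n (n + 1) = csqrt k * jacobi_sn k (\<xi> n (n + 1))"
    \<comment> \<open>\<open>x n\<close> is the argument of sn in \<open>u n\<close>; the labels \<open>2n - 1, 2n\<close> (rather than
        \<open>2n, 2n + 1\<close>) are the ones for which \<open>u\<close> is in phase with \<open>z\<close> and \<open>\<gamma>\<close>\<close>
    and "\<And>n. (x (2 * n - 1), x (2 * n)) = (\<xi> n n, \<xi> n (n + 1))"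
    and "\<And>n. (u (2 * n - 1), u (2 * n)) = (v n n / csqrt k, v n (n + 1) / csqrt k)"
  shows "\<forall>n. (\<forall>w \<in> {z n, \<gamma> n, x (n - 1), x n, x (n + 1)}. jacobi_regular k w) \<longrightarrow>
      jacobi_cn k (\<gamma> n) * jacobi_dn k (\<gamma> n) * (1 - k\<^sup>2 * jacobi_sn k (z n) ^ 4)
          * u n * (u (n + 1) + u (n - 1))
      - jacobi_cn k (z n) * jacobi_dn k (z n)
          * (1 - k\<^sup>2 * (jacobi_sn k (z n))\<^sup>2 * (jacobi_sn k (\<gamma> n))\<^sup>2)
          * (u (n + 1) * u (n - 1) + (u n)\<^sup>2)
      + ((jacobi_cn k (z n))\<^sup>2 - (jacobi_cn k (\<gamma> n))\<^sup>2) * jacobi_cn k (z n) * jacobi_dn k (z n)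
          * (1 + k\<^sup>2 * (u n)\<^sup>2 * u (n + 1) * u (n - 1))
      = 0"
proof (intro allI impI)
  fix n :: int
  assume reg: "\<forall>w \<in> {z n, \<gamma> n, x (n - 1), x n, x (n + 1)}. jacobi_regular k w"
  have x_odd: "x (2 * m - 1) = \<xi>0 + of_int m * (\<alpha>0 - \<beta>0) + of_int (m * (m - 1)) * \<phi>"
    and x_even: "x (2 * m) = \<xi>0 - \<beta>0 + of_int m * (\<alpha>0 - \<beta>0) + of_int (m\<^sup>2) * \<phi>" for m
    using assms(7,8,11)[of m] by simp_all
  \<comment> \<open>The index \<open>2 * m + 1\<close> has the label form
    \<open>2 * (m + 1) - 1\<close>, so the formula is read at \<open>m + 1\<close>.\<close>
  have x_odd': "x (2 * m + 1) = \<xi>0 + of_int (m + 1) * (\<alpha>0 - \<beta>0) + of_int ((m + 1) * m) * \<phi>" for m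
  proof -
    have "2 * (m + 1) - 1 = 2 * m + 1" by simp
    then show ?thesis using x_odd[of "m + 1"] by (simp only: add_diff_cancel_right')
  qed
  \<comment> \<open>The factor \<open>csqrt k\<close> in \<open>v\<close> cancels because
    \<open>k \<noteq> 0\<close>.\<close>
  have u: "u m = jacobi_sn k (x m)" for m
  proof (cases "even m")
    case True
    then obtain j where "m = 2 * j" by (rule evenE)
    then show ?thesis using assms(1) assms(10-12)[of j] by simp
  next
    case False
    then obtain j where "m = 2 * j + 1" by (rule oddE)
    then have "m = 2 * (j + 1) - 1" by simp
    then show ?thesis using assms(1) assms(9,11,12)[of "j + 1"] by simp
  qed
  \<comment> \<open>Half of \<open>x (n + 1) - x (n - 1)\<close> is \<open>z n\<close>, since
    \<open>\<gamma>e + \<gamma>o = \<phi> / 2\<close>. Half of the second difference of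
    \<open>x\<close> is constant on each parity class: \<gamma>e at even and \<gamma>o at odd
    \<open>n\<close>.\<close>
  have "x (n + 1) = x n + \<gamma> n + z n \<and> x (n - 1) = x n + \<gamma> n - z n"
  proof (cases "even n")
    case True
    then obtain j where j: "n = 2 * j" by (rule evenE)
    then have x: "x n = \<xi>0 - \<beta>0 + of_int j * (\<alpha>0 - \<beta>0) + of_int (j\<^sup>2) * \<phi>"
      "x (n + 1) = \<xi>0 + of_int (j + 1) * (\<alpha>0 - \<beta>0) + of_int ((j + 1) * j) * \<phi>"
      "x (n - 1) = \<xi>0 + of_int j * (\<alpha>0 - \<beta>0) + of_int (j * (j - 1)) * \<phi>"
      using x_even[of j] x_odd'[of j] x_odd[of j] by (simp_all only:)
    have \<gamma>z: "\<gamma> n = \<gamma>e" "z n = (\<gamma>e + \<gamma>o) * (2 * of_int j) + z0" using True j assms(5,6) by simp_all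
    show ?thesis
      unfolding x \<gamma>z assms(2-4) by (simp add: power2_eq_square field_simps)
  next
    case False
    then obtain j where j: "n = 2 * j + 1" by (rule oddE)
    then have "n + 1 = 2 * (j + 1)" "n - 1 = 2 * j" by simp_all
    with j have x: "x n = \<xi>0 + of_int (j + 1) * (\<alpha>0 - \<beta>0) + of_int ((j + 1) * j) * \<phi>"
      "x (n + 1) = \<xi>0 - \<beta>0 + of_int (j + 1) * (\<alpha>0 - \<beta>0) + of_int ((j + 1)\<^sup>2) * \<phi>"
      "x (n - 1) = \<xi>0 - \<beta>0 + of_int j * (\<alpha>0 - \<beta>0) + of_int (j\<^sup>2) * \<phi>"
      using x_even[of j] x_odd'[of j] x_even[of "j + 1"] by (simp_all only:)
    have \<gamma>z: "\<gamma> n = \<gamma>o" "z n = (\<gamma>e + \<gamma>o) * (2 * of_int j + 1) + z0" using False j assms(5,6) by simp_all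
    show ?thesis
      unfolding x \<gamma>z assms(2-4) by (simp add: power2_eq_square field_simps)
  qed
  then show "jacobi_cn k (\<gamma> n) * jacobi_dn k (\<gamma> n) * (1 - k\<^sup>2 * jacobi_sn k (z n) ^ 4)
          * u n * (u (n + 1) + u (n - 1))
      - jacobi_cn k (z n) * jacobi_dn k (z n)
          * (1 - k\<^sup>2 * (jacobi_sn k (z n))\<^sup>2 * (jacobi_sn k (\<gamma> n))\<^sup>2)
          * (u (n + 1) * u (n - 1) + (u n)\<^sup>2)
      + ((jacobi_cn k (z n))\<^sup>2 - (jacobi_cn k (\<gamma> n))\<^sup>2) * jacobi_cn k (z n) * jacobi_dn k (z n)
          * (1 + k\<^sup>2 * (u n)\<^sup>2 * u (n + 1) * u (n - 1))
      = 0"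
    using jacobi_difference_equation[OF assms(1), of "x n" "\<gamma> n" "z n"] reg unfolding u by simp
qed

end
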